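(* Let $\mathbf{x}:(U,0)\to(\mathbb{R}^3,0)$ be a proper frontal with extendable normal curvature and let $0$ be a singularity of rank $1$ (i.e. $\mathrm{rank}(D\mathbf{x}(0))=1$). Then, after a rigid motion of $\mathbb{R}^3$ and a change of coordinates on a neighborhood of $0\in\mathbb{R}^2$, $\mathbf{x}$ can be represented by the formula $$\Big(u,\ b(u,v),\ \int_0^v\!\int_0^{t_2}h(u,t_1)b_v(u,t_1)\,dt_1\,b_v(u,t_2)\,dt_2+\int_0^v\!\int_0^u l(t_1)\,dt_1\,b_v(u,t_2)\,dt_2+\int_0^u\!\int_0^{t_2}l(t_1)\,dt_1\,b_u(t_2,0)\,dt_2+\int_0^u\!\int_0^{t_2}r(t_1)\,dt_1\,dt_2\Big),$$ where $b=b(u,v)$, $h=h(u,v)$, $l$ and $r$ (the last two of one variable) are smooth real-valued functions defined on neighborhoods of the origin of $\mathbb{R}^2$, $\mathbb{R}^2$, $\mathbb{R}$, $\mathbb{R}$ respectively.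
   Context: All maps are $C^\infty$ and $U\subset\mathbb{R}^2$ is open. $D$ denotes the Jacobian matrix of a map. A tangent moving basis (tmb) of $\mathbf{x}:U\to\mathbb{R}^3$ is a smooth map $\mathbf{\Omega}=(\mathbf{w}_1\ \mathbf{w}_2):U\to\mathcal{M}_{3\times2}(\mathbb{R})$ with columns linearly independent at every point and $\mathbf{x}_u,\mathbf{x}_v\in\mathrm{span}(\mathbf{w}_1,\mathbf{w}_2)$. The map $\mathbf{x}$ is a frontal if near each point there is a smooth unit vector field orthogonal to $\mathbf{x}_u,\mathbf{x}_v$; equivalently, tmbs exist locally, and frontals are always assumed to have a global tmb. The normal field induced by $\mathbf{\Omega}$ is $\mathbf{n}=\frac{\mathbf{w}_1\times\mathbf{w}_2}{\|\mathbf{w}_1\times\mathbf{w}_2\|}$. $\Sigma(\mathbf{x})$ is the set of points where $\mathbf{x}$ is not immersive; the frontal is proper if $\Sigma(\mathbf{x})$ has empty interior. The notation $\mathbf{x}:(U,0)\to(\mathbb{R}^3,0)$ means a map germ with $\mathbf{x}(0)=0$. Set $\mathbf{I}=D\mathbf{x}^TD\mathbf{x}$, $\mathbf{II}=-D\mathbf{x}^TD\mathbf{n}$ and $\mathbf{\Lambda}_\Omega=D\mathbf{x}^T\mathbf{\Omega}(\mathbf{\Omega}^T\mathbf{\Omega})^{-1}$. Normal curvature: at $p\in\Sigma(\mathbf{x})^c$, $k_p(\zeta)=\frac{\zeta^T\mathbf{II}\zeta}{\zeta^T\mathbf{I}\zeta}$ for $\zeta\in\mathbb{R}^2-\{0\}$.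 It is extendable if $(p,\omega)\mapsto k_p(\mathbf{\Lambda}_\Omega^{-T}\omega)$ on $\Sigma(\mathbf{x})^c\times(\mathbb{R}^2-\{0\})$ has a smooth extension to $U\times(\mathbb{R}^2-\{0\})$, where $\mathbf{\Omega}$ is a tmb of $\mathbf{x}$. *)

theory Defs
  imports "HOL-Analysis.Analysis"
begin

unbundle no cross3_syntax
unbundle set_product_syntax

text \<open>
  Smoothness (class \<open>C\<^sup>\<infinity>\<close>) on an open set: all iterated directional derivatives exist, are
  differentiable and are continuous. Meaningful for open \<open>S\<close> and finite-dimensional domain only.
\<close>

primrec higher_differentiable_on ::
  "'a::real_normed_vector set \<Rightarrow> ('a \<Rightarrow> 'b::real_normed_vector) \<Rightarrow> nat \<Rightarrow> bool" where
  "higher_differentiable_on S f 0 \<longleftrightarrow> continuous_on S f"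
| "higher_differentiable_on S f (Suc n) \<longleftrightarrow>
     (\<forall>x\<in>S. f differentiable (at x)) \<and>
     (\<forall>v. higher_differentiable_on S (\<lambda>x. frechet_derivative f (at x) v) n)"

definition smooth_on ::
  "'a::real_normed_vector set \<Rightarrow> ('a \<Rightarrow> 'b::real_normed_vector) \<Rightarrow> bool" where
  "smooth_on S f \<longleftrightarrow> (\<forall>n. higher_differentiable_on S f n)"

definition partial :: "'n::finite \<Rightarrow> (real^'n \<Rightarrow> 'b::real_normed_vector) \<Rightarrow> real^'n \<Rightarrow> 'b" where
  "partial i f p = frechet_derivative f (at p) (axis i 1)"

definition diffeomorphism ::
  "'a::real_normed_vector set \<Rightarrow> 'b::real_normed_vector set \<Rightarrow> ('a \<Rightarrow> 'b) \<Rightarrow> bool" where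
  "diffeomorphism V W \<phi> \<longleftrightarrow>
     open V \<and> open W \<and> smooth_on V \<phi> \<and> bij_betw \<phi> V W \<and> smooth_on W (inv_into V \<phi>)"

text \<open>Rigid motions are orientation preserving here: a rotation followed by a translation.\<close>

definition rigid_motion :: "(real^3 \<Rightarrow> real^3) \<Rightarrow> bool" where
  "rigid_motion T \<longleftrightarrow> (\<exists>A c. rotation_matrix A \<and> T = (\<lambda>y. A *v y + c))"

text \<open>A \<open>3 \<times> 2\<close> matrix has type \<^typ>\<open>real^2^3\<close>; its columns are vectors of type \<^typ>\<open>real^3\<close>.\<close>

definition tangent_moving_basis ::
  "(real^2) set \<Rightarrow> (real^2 \<Rightarrow> real^3) \<Rightarrow> (real^2 \<Rightarrow> real^2^3) \<Rightarrow> bool" where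
  "tangent_moving_basis U x \<Omega> \<longleftrightarrow>
     smooth_on U \<Omega> \<and>
     (\<forall>p\<in>U. column 1 (\<Omega> p) \<noteq> column 2 (\<Omega> p) \<and>
            independent {column 1 (\<Omega> p), column 2 (\<Omega> p)} \<and>
            partial 1 x p \<in> span {column 1 (\<Omega> p), column 2 (\<Omega> p)} \<and>
            partial 2 x p \<in> span {column 1 (\<Omega> p), column 2 (\<Omega> p)})"

text \<open>As usual, a frontal comes with the existence of a global tangent moving basis.\<close>

definition frontal :: "(real^2) set \<Rightarrow> (real^2 \<Rightarrow> real^3) \<Rightarrow> bool" where
  "frontal U x \<longleftrightarrow>
     smooth_on U x \<and>
     (\<forall>p\<in>U. \<exists>V \<nu>. open V \<and> p \<in> V \<and> V \<subseteq> U \<and> smooth_on V \<nu> \<and>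
        (\<forall>q\<in>V. norm (\<nu> q) = 1 \<and> \<nu> q \<bullet> partial 1 x q = 0 \<and> \<nu> q \<bullet> partial 2 x q = 0)) \<and>
     (\<exists>\<Omega>. tangent_moving_basis U x \<Omega>)"

definition singular_set :: "(real^2) set \<Rightarrow> (real^2 \<Rightarrow> real^3) \<Rightarrow> (real^2) set" where
  "singular_set U x = {p \<in> U. \<not> inj (frechet_derivative x (at p))}"

definition proper_frontal :: "(real^2) set \<Rightarrow> (real^2 \<Rightarrow> real^3) \<Rightarrow> bool" where
  "proper_frontal U x \<longleftrightarrow> frontal U x \<and> interior (singular_set U x) = {}"

definition normal_field :: "(real^2 \<Rightarrow> real^2^3) \<Rightarrow> real^2 \<Rightarrow> real^3" where
  "normal_field \<Omega> p =
     (let w = cross3 (column 1 (\<Omega> p)) (column 2 (\<Omega> p)) in (1 / norm w) *\<^sub>R w)"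

definition first_form :: "(real^2 \<Rightarrow> real^3) \<Rightarrow> real^2 \<Rightarrow> real^2^2" where
  "first_form x p = transpose (jacobian x (at p)) ** jacobian x (at p)"

definition second_form ::
  "(real^2 \<Rightarrow> real^3) \<Rightarrow> (real^2 \<Rightarrow> real^2^3) \<Rightarrow> real^2 \<Rightarrow> real^2^2" where
  "second_form x \<Omega> p = - (transpose (jacobian x (at p)) ** jacobian (normal_field \<Omega>) (at p))"

definition Lambda ::
  "(real^2 \<Rightarrow> real^3) \<Rightarrow> (real^2 \<Rightarrow> real^2^3) \<Rightarrow> real^2 \<Rightarrow> real^2^2" where
  "Lambda x \<Omega> p =
     transpose (jacobian x (at p)) ** \<Omega> p ** matrix_inv (transpose (\<Omega> p) ** \<Omega> p)"

definition normal_curvature ::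
  "(real^2 \<Rightarrow> real^3) \<Rightarrow> (real^2 \<Rightarrow> real^2^3) \<Rightarrow> real^2 \<Rightarrow> real^2 \<Rightarrow> real" where
  "normal_curvature x \<Omega> p \<zeta> =
     (\<zeta> \<bullet> (second_form x \<Omega> p *v \<zeta>)) / (\<zeta> \<bullet> (first_form x p *v \<zeta>))"

text \<open>
  The choice of \<open>\<Omega>\<close> is immaterial: another basis \<open>\<Omega> B\<close>, with \<open>B\<close> smooth and invertible, replaces
  \<open>\<Lambda>\<^sup>-\<^sup>T\<close> by \<open>\<Lambda>\<^sup>-\<^sup>T B\<close> and the normal by \<open>\<plusminus>\<close> itself, with locally constant sign.
\<close>

definition extendable_normal_curvature :: "(real^2) set \<Rightarrow> (real^2 \<Rightarrow> real^3) \<Rightarrow> bool" where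
  "extendable_normal_curvature U x \<longleftrightarrow>
     (\<exists>\<Omega>. tangent_moving_basis U x \<Omega> \<and>
        (\<exists>K :: (real^2) \<times> (real^2) \<Rightarrow> real.
           smooth_on (U \<times> (- {0})) K \<and>
           (\<forall>p \<in> U - singular_set U x. \<forall>\<omega>. \<omega> \<noteq> 0 \<longrightarrow>
              K (p, \<omega>) = normal_curvature x \<Omega> p (transpose (matrix_inv (Lambda x \<Omega> p)) *v \<omega>))))"

text \<open>
  Interval integrals are oriented (\<open>LBINT t=a..b\<close> changes sign when \<open>a\<close> and \<open>b\<close> are swapped);
  \<open>u\<close> and \<open>v\<close> may be negative.
\<close>

definition normal_form ::
  "(real^2 \<Rightarrow> real) \<Rightarrow> (real^2 \<Rightarrow> real) \<Rightarrow> (real \<Rightarrow> real) \<Rightarrow> (real \<Rightarrow> real) \<Rightarrow> real \<Rightarrow> real \<Rightarrow> real^3" where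
  "normal_form b h l r u v =
     vector
      [u,
       b (vector [u, v]),
       (LBINT t2=0..v. (LBINT t1=0..t2. h (vector [u, t1]) * partial 2 b (vector [u, t1]))
                        * partial 2 b (vector [u, t2]))
       + (LBINT t2=0..v. (LBINT t1=0..u. l t1) * partial 2 b (vector [u, t2]))
       + (LBINT t2=0..u. (LBINT t1=0..t2. l t1) * partial 1 b (vector [t2, 0]))
       + (LBINT t2=0..u. (LBINT t1=0..t2. r t1))]"

end

theory Submission
  imports Defs
begin

text \<open>
  A rotation makes the limiting tangent plane at \<open>0\<close> horizontal and the derivative of the first
  component of \<open>x\<close> at \<open>0\<close> nonzero. That component is then a coordinate near \<open>0\<close>, so
  \<open>x\<close> becomes \<open>(u, b, c)\<close>. The tangent planes of the moving basis stay non-vertical near \<open>0\<close> and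
  have smooth slopes \<open>g1\<close>, \<open>g2\<close>; tangency of \<open>x\<^sub>u = (1, b\<^sub>u, c\<^sub>u)\<close> and \<open>x\<^sub>v = (0, b\<^sub>v, c\<^sub>v)\<close> means
  \<open>c\<^sub>u = g1 + g2 b\<^sub>u\<close> and \<open>c\<^sub>v = g2 b\<^sub>v\<close>.

  The curvature hypothesis enters through a single direction. At a regular point
  \<open>k\<^sub>p(\<Lambda>\<^sup>-\<^sup>T \<omega>)\<close> is the normal curvature in the direction of the tangent vector \<open>\<Omega> \<omega>\<close>
  (\<open>normal_curvature_in_tangent_coordinates\<close>). Choosing \<open>\<omega>\<close> smoothly with \<open>\<Omega> \<omega> = (0, 1, g2)\<close>, which
  is \<open>x\<^sub>v / b\<^sub>v\<close>, the curvature becomes a nonvanishing smooth multiple of \<open>(g2)\<^sub>v / b\<^sub>v\<close>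
  (\<open>slope2_derivative_regular\<close>). Its smooth extension therefore provides a smooth \<open>h\<close> with
  \<open>(g2)\<^sub>v = h b\<^sub>v\<close> at regular points, and everywhere by continuity, as the singular set has
  empty interior (\<open>eq_off_singular_set_imp_eq\<close>).

  With \<open>l(u) = (g2)\<^sub>u(u, 0)\<close> and \<open>r(u) = (g1)\<^sub>u(u, 0)\<close>, and \<open>c\<close>, \<open>g1\<close>, \<open>g2\<close> vanishing at \<open>0\<close>, integrating
  these three equations gives the formula (\<open>normal_form_eq_graph\<close>).
\<close>

section \<open>Calculus of smooth maps\<close>

lemma higher_differentiable_on_imp_differentiable:
  assumes "higher_differentiable_on S f (Suc n)" "x \<in> S"
  shows "(f has_derivative frechet_derivative f (at x)) (at x)"
  using assms frechet_derivative_works by auto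

lemma higher_differentiable_on_SucI:
  assumes "\<And>x. x \<in> S \<Longrightarrow> (f has_derivative f' x) (at x)"
    and "\<And>v. higher_differentiable_on S (\<lambda>x. frechet_derivative f (at x) v) n"
  shows "higher_differentiable_on S f (Suc n)"
  using assms by (auto simp: differentiable_def)

lemma higher_differentiable_on_continuous:
  "higher_differentiable_on S f n \<Longrightarrow> continuous_on S f"
proof (cases n)
  case (Suc m)
  assume "higher_differentiable_on S f n"
  then show ?thesis
    using Suc by (auto intro!: continuous_at_imp_continuous_on differentiable_imp_continuous_within)
qed simp

lemma higher_differentiable_on_Suc:
  "higher_differentiable_on S f (Suc n) \<Longrightarrow> higher_differentiable_on S f n"
proof (induction n arbitrary: f)
  case 0
  then show ?case by (metis higher_differentiable_on.simps(1) higher_differentiable_on_continuous)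
next
  case (Suc n)
  have *: "\<forall>x\<in>S. f differentiable (at x)"
    "\<And>v. higher_differentiable_on S (\<lambda>x. frechet_derivative f (at x) v) (Suc n)"
    using Suc.prems unfolding higher_differentiable_on.simps(2)[of S f "Suc n"] by blast+
  show ?case
    unfolding higher_differentiable_on.simps(2)[of S f n] using * Suc.IH by blast
qed

lemma higher_differentiable_on_subset:
  assumes "higher_differentiable_on S f n" "T \<subseteq> S"
  shows "higher_differentiable_on T f n"
  using assms
  by (induction n arbitrary: f) (auto intro: continuous_on_subset)

lemma higher_differentiable_on_cong:
  assumes "open S" "higher_differentiable_on S f n" "\<And>x. x \<in> S \<Longrightarrow> f x = g x"
  shows "higher_differentiable_on S g n"
  using assms(2,3)
proof (induction n arbitrary: f g)
  case 0
  then show ?case by (auto cong: continuous_on_cong)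
next
  case (Suc n)
  have d: "(g has_derivative frechet_derivative f (at x)) (at x)" if "x \<in> S" for x
    using has_derivative_transform_within_open[OF
      higher_differentiable_on_imp_differentiable[OF Suc.prems(1) that] \<open>open S\<close> that] Suc.prems(2)
    by blast
  show ?case
  proof (rule higher_differentiable_on_SucI)
    show "(g has_derivative frechet_derivative f (at x)) (at x)" if "x \<in> S" for x
      by (rule d[OF that])
    fix v
    have "higher_differentiable_on S (\<lambda>x. frechet_derivative f (at x) v) n"
      using Suc.prems(1) by simp
    moreover have "frechet_derivative f (at x) v = frechet_derivative g (at x) v" if "x \<in> S" for x
      using frechet_derivative_at[OF d[OF that]] by simp
    ultimately show "higher_differentiable_on S (\<lambda>x. frechet_derivative g (at x) v) n"
      by (rule Suc.IH)
  qed
qed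

text \<open>The working form of the recursion: any explicit formula for the derivative may be used.\<close>

lemma higher_differentiable_on_Suc_of_derivative:
  assumes "open S" "\<And>x. x \<in> S \<Longrightarrow> (f has_derivative f' x) (at x)"
    and "\<And>v. higher_differentiable_on S (\<lambda>x. f' x v) n"
  shows "higher_differentiable_on S f (Suc n)"
proof (rule higher_differentiable_on_SucI[OF assms(2)])
  show "higher_differentiable_on S (\<lambda>x. frechet_derivative f (at x) v) n" for v
    by (rule higher_differentiable_on_cong[OF \<open>open S\<close> assms(3)[of v]])
      (simp add: frechet_derivative_at[OF assms(2)])
qed

lemma higher_differentiable_on_const: "higher_differentiable_on S (\<lambda>x. c) n"
  by (induction n arbitrary: c) auto

lemma higher_differentiable_on_bounded_linear_comp:
  assumes "open S" "bounded_linear L" "higher_differentiable_on S f n"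
  shows "higher_differentiable_on S (\<lambda>x. L (f x)) n"
  using assms(3)
proof (induction n arbitrary: f)
  case 0
  then show ?case using assms(2) by (auto intro: bounded_linear.continuous_on)
next
  case (Suc n)
  show ?case
    by (rule higher_differentiable_on_Suc_of_derivative[OF \<open>open S\<close> bounded_linear.has_derivative[OF assms(2)
        higher_differentiable_on_imp_differentiable[OF Suc.prems]]])
      (use Suc in auto)
qed

lemma higher_differentiable_on_bounded_linear:
  assumes "open S" "bounded_linear L"
  shows "higher_differentiable_on S L n"
proof (cases n)
  case 0
  then show ?thesis
    using assms(2) by (simp add: linear_continuous_on)
next
  case (Suc m)
  show ?thesis
    unfolding Suc
    by (rule higher_differentiable_on_Suc_of_derivative[OF \<open>open S\<close> bounded_linear_imp_has_derivative[OF assms(2)]])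
      (simp add: higher_differentiable_on_const)
qed

lemma higher_differentiable_on_add:
  assumes "open S" "higher_differentiable_on S f n" "higher_differentiable_on S g n"
  shows "higher_differentiable_on S (\<lambda>x. f x + g x) n"
  using assms(2,3)
proof (induction n arbitrary: f g)
  case 0
  then show ?case by (auto intro: continuous_on_add)
next
  case (Suc n)
  show ?case
    by (rule higher_differentiable_on_Suc_of_derivative[OF \<open>open S\<close> has_derivative_add[OF
        higher_differentiable_on_imp_differentiable[OF Suc.prems(1)]
        higher_differentiable_on_imp_differentiable[OF Suc.prems(2)]]])
      (use Suc in auto)
qed

lemma higher_differentiable_on_sum:
  assumes "open S" "finite I" "\<And>i. i \<in> I \<Longrightarrow> higher_differentiable_on S (f i) n"
  shows "higher_differentiable_on S (\<lambda>x. \<Sum>i\<in>I. f i x) n"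
  using assms(2,3)
  by (induction I) (simp_all add: higher_differentiable_on_const higher_differentiable_on_add[OF \<open>open S\<close>])

lemma (in bounded_bilinear) higher_differentiable_on:
  assumes "open S" "higher_differentiable_on S f n" "higher_differentiable_on S g n"
  shows "higher_differentiable_on S (\<lambda>x. prod (f x) (g x)) n"
  using assms(2,3)
proof (induction n arbitrary: f g)
  case 0
  then show ?case by (auto intro: continuous_on)
next
  case (Suc n)
  show ?case
    by (rule higher_differentiable_on_Suc_of_derivative[OF \<open>open S\<close> FDERIV[OF
        higher_differentiable_on_imp_differentiable[OF Suc.prems(1)]
        higher_differentiable_on_imp_differentiable[OF Suc.prems(2)]]])
      (use Suc in \<open>auto intro!: higher_differentiable_on_add[OF \<open>open S\<close>] Suc.IH
         intro: higher_differentiable_on_Suc[of S f n] higher_differentiable_on_Suc[of S g n]\<close>)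
qed

text \<open>All real exponents are treated at once because differentiation lowers the exponent; the
  exponents \<open>-1\<close> and \<open>1/2\<close> give quotients and norms.\<close>

lemma higher_differentiable_on_powr:
  fixes f :: "'a::real_normed_vector \<Rightarrow> real"
  assumes "open S" "\<And>x. x \<in> S \<Longrightarrow> f x > 0" "higher_differentiable_on S f n"
  shows "higher_differentiable_on S (\<lambda>x. f x powr a) n"
  using assms(3)
proof (induction n arbitrary: a)
  case 0
  then show ?case using assms(2) by (fastforce intro!: continuous_on_powr)
next
  case (Suc n)
  have f: "higher_differentiable_on S f n"
    using Suc.prems by (rule higher_differentiable_on_Suc)
  show ?case
  proof (rule higher_differentiable_on_Suc_of_derivative[OF \<open>open S\<close>])
    fix x assume "x \<in> S"
    then show "((\<lambda>x. f x powr a) has_derivative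
        (\<lambda>v. (a *\<^sub>R f x powr (a - 1)) * frechet_derivative f (at x) v)) (at x)"
      using has_derivative_powr[OF higher_differentiable_on_imp_differentiable[OF Suc.prems \<open>x \<in> S\<close>]
          has_derivative_const[of a], of] assms(2)[of x]
      by (auto simp: powr_diff field_simps elim!: has_derivative_eq_rhs)
  next
    show "higher_differentiable_on S (\<lambda>x. (a *\<^sub>R f x powr (a - 1)) * frechet_derivative f (at x) v) n" for v
      by (rule bounded_bilinear.higher_differentiable_on[OF bounded_bilinear_mult \<open>open S\<close>
          higher_differentiable_on_bounded_linear_comp[OF \<open>open S\<close> bounded_linear_scaleR_right Suc.IH[OF f]]])
        (use Suc.prems in simp)
  qed
qed

text \<open>
  A finite-dimensional middle space lets the derivative of \<open>f\<close> at \<open>g x\<close>, applied to a direction that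
  varies with \<open>x\<close>, be expanded into derivatives in fixed directions, to which the induction
  hypothesis applies.
\<close>

lemma higher_differentiable_on_compose:
  fixes f :: "'b::euclidean_space \<Rightarrow> 'c::real_normed_vector" and g :: "'a::real_normed_vector \<Rightarrow> 'b"
  assumes "open S" "open T" "g ` S \<subseteq> T"
    and "higher_differentiable_on T f n" "higher_differentiable_on S g n"
  shows "higher_differentiable_on S (\<lambda>x. f (g x)) n"
  using assms(4,5)
proof (induction n arbitrary: f)
  case 0
  then show ?case using assms(3) by (auto intro: continuous_on_compose2)
next
  case (Suc n)
  have g: "higher_differentiable_on S g n"
    using Suc.prems(2) by (rule higher_differentiable_on_Suc)
  let ?f = "\<lambda>y. frechet_derivative f (at y)" and ?g = "\<lambda>x. frechet_derivative g (at x)"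
  show ?case
  proof (rule higher_differentiable_on_Suc_of_derivative[OF \<open>open S\<close>])
    fix x assume "x \<in> S"
    then have f': "(f has_derivative ?f (g x)) (at (g x))" and g': "(g has_derivative ?g x) (at x)"
      using assms(3) higher_differentiable_on_imp_differentiable[OF Suc.prems(1)]
        higher_differentiable_on_imp_differentiable[OF Suc.prems(2)] by auto
    have lin: "linear (?f (g x))"
      using f' by (rule has_derivative_linear)
    have "?f (g x) (?g x v) = (\<Sum>i\<in>Basis. (?g x v \<bullet> i) *\<^sub>R ?f (g x) i)" for v
      by (subst euclidean_representation[of "?g x v", symmetric])
        (simp only: linear_sum[OF lin] linear_cmul[OF lin])
    then show "((\<lambda>x. f (g x)) has_derivative (\<lambda>v. \<Sum>i\<in>Basis. (?g x v \<bullet> i) *\<^sub>R ?f (g x) i)) (at x)"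
      using has_derivative_compose[OF g' f'] by simp
  next
    fix v
    show "higher_differentiable_on S (\<lambda>x. \<Sum>i\<in>Basis. (?g x v \<bullet> i) *\<^sub>R ?f (g x) i) n"
    proof (intro higher_differentiable_on_sum[OF \<open>open S\<close>] finite_Basis
        bounded_bilinear.higher_differentiable_on[OF bounded_bilinear_scaleR \<open>open S\<close>])
      fix i :: 'b
      show "higher_differentiable_on S (\<lambda>x. ?g x v \<bullet> i) n"
        by (rule higher_differentiable_on_bounded_linear_comp[OF \<open>open S\<close> bounded_linear_inner_left])
          (use Suc.prems in simp)
      show "higher_differentiable_on S (\<lambda>x. ?f (g x) i) n"
        by (rule Suc.IH[OF _ g]) (use Suc.prems in simp)
    qed
  qed
qed

lemma smooth_onI: "(\<And>n. higher_differentiable_on S f n) \<Longrightarrow> smooth_on S f"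
  by (simp add: smooth_on_def)

lemma smooth_onD: "smooth_on S f \<Longrightarrow> higher_differentiable_on S f n"
  by (simp add: smooth_on_def)

lemma smooth_on_has_derivative:
  "smooth_on S f \<Longrightarrow> x \<in> S \<Longrightarrow> (f has_derivative frechet_derivative f (at x)) (at x)"
  by (rule higher_differentiable_on_imp_differentiable[OF smooth_onD])

lemma smooth_on_continuous_on: "smooth_on S f \<Longrightarrow> continuous_on S f"
  by (rule higher_differentiable_on_continuous[OF smooth_onD[where n = 0]])

lemma smooth_on_frechet_derivative:
  "smooth_on S f \<Longrightarrow> smooth_on S (\<lambda>x. frechet_derivative f (at x) v)"
  unfolding smooth_on_def by (metis higher_differentiable_on.simps(2))

lemma smooth_on_partial: "smooth_on S f \<Longrightarrow> smooth_on S (partial i f)"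
  unfolding partial_def by (rule smooth_on_frechet_derivative)

lemma smooth_on_subset: "smooth_on S f \<Longrightarrow> T \<subseteq> S \<Longrightarrow> smooth_on T f"
  by (auto simp: smooth_on_def intro: higher_differentiable_on_subset)

lemma smooth_on_cong:
  "open S \<Longrightarrow> smooth_on S f \<Longrightarrow> (\<And>x. x \<in> S \<Longrightarrow> f x = g x) \<Longrightarrow> smooth_on S g"
  by (auto simp: smooth_on_def intro: higher_differentiable_on_cong)

lemma smooth_on_const: "smooth_on S (\<lambda>x. c)"
  by (simp add: smooth_on_def higher_differentiable_on_const)

lemma smooth_on_bounded_linear: "open S \<Longrightarrow> bounded_linear L \<Longrightarrow> smooth_on S L"
  by (simp add: smooth_on_def higher_differentiable_on_bounded_linear)

lemma smooth_on_bounded_linear_comp: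
  "open S \<Longrightarrow> bounded_linear L \<Longrightarrow> smooth_on S f \<Longrightarrow> smooth_on S (\<lambda>x. L (f x))"
  by (simp add: smooth_on_def higher_differentiable_on_bounded_linear_comp)

lemma smooth_on_add: "open S \<Longrightarrow> smooth_on S f \<Longrightarrow> smooth_on S g \<Longrightarrow> smooth_on S (\<lambda>x. f x + g x)"
  by (simp add: smooth_on_def higher_differentiable_on_add)

lemma (in bounded_bilinear) smooth_on:
  "open S \<Longrightarrow> smooth_on S f \<Longrightarrow> smooth_on S g \<Longrightarrow> smooth_on S (\<lambda>x. prod (f x) (g x))"
  by (simp add: smooth_on_def higher_differentiable_on)

lemmas smooth_on_mult = bounded_bilinear.smooth_on[OF bounded_bilinear_mult]
lemmas smooth_on_scaleR = bounded_bilinear.smooth_on[OF bounded_bilinear_scaleR]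
lemmas smooth_on_inner = bounded_bilinear.smooth_on[OF bounded_bilinear_inner]

lemma smooth_on_cross3:
  "open S \<Longrightarrow> smooth_on S f \<Longrightarrow> smooth_on S g \<Longrightarrow> smooth_on S (\<lambda>x. cross3 (f x) (g x))"
  by (rule bounded_bilinear.smooth_on) (simp_all add: bilinear_cross flip: bilinear_conv_bounded_bilinear)

lemma smooth_on_minus: "open S \<Longrightarrow> smooth_on S f \<Longrightarrow> smooth_on S (\<lambda>x. - f x)"
  by (rule smooth_on_bounded_linear_comp) (auto intro: bounded_linear_minus bounded_linear_ident)

lemma smooth_on_powr:
  fixes f :: "'a::real_normed_vector \<Rightarrow> real"
  shows "open S \<Longrightarrow> smooth_on S f \<Longrightarrow> (\<And>x. x \<in> S \<Longrightarrow> f x > 0) \<Longrightarrow> smooth_on S (\<lambda>x. f x powr a)"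
  by (simp add: smooth_on_def higher_differentiable_on_powr)

lemma smooth_on_divide:
  fixes f g :: "'a::real_normed_vector \<Rightarrow> real"
  assumes "open S" "smooth_on S f" "smooth_on S g" "\<And>x. x \<in> S \<Longrightarrow> g x > 0"
  shows "smooth_on S (\<lambda>x. f x / g x)"
proof (rule smooth_on_cong[OF \<open>open S\<close>])
  show "smooth_on S (\<lambda>x. f x * g x powr (-1))"
    by (intro smooth_on_mult smooth_on_powr assms)
  show "f x * g x powr (-1) = f x / g x" if "x \<in> S" for x
    using assms(4)[OF that] by (simp add: powr_minus_divide)
qed

lemma smooth_on_normalize:
  fixes f :: "'a::real_normed_vector \<Rightarrow> 'b::real_inner"
  assumes "open S" "smooth_on S f" "\<And>x. x \<in> S \<Longrightarrow> f x \<noteq> 0"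
  shows "smooth_on S (\<lambda>x. (1 / norm (f x)) *\<^sub>R f x)"
proof (rule smooth_on_cong[OF \<open>open S\<close>])
  show "smooth_on S (\<lambda>x. (f x \<bullet> f x) powr (-1/2) *\<^sub>R f x)"
    by (intro smooth_on_scaleR smooth_on_powr smooth_on_inner assms) (simp add: assms)
  show "(f x \<bullet> f x) powr (-1/2) *\<^sub>R f x = (1 / norm (f x)) *\<^sub>R f x" if "x \<in> S" for x
    using assms(3)[OF that] powr_minus_divide[of "f x \<bullet> f x" "1/2"]
    by (simp add: powr_half_sqrt norm_eq_sqrt_inner)
qed

lemma smooth_on_compose:
  fixes f :: "'b::euclidean_space \<Rightarrow> 'c::real_normed_vector" and g :: "'a::real_normed_vector \<Rightarrow> 'b"
  assumes "open S" "open T" "smooth_on T f" "smooth_on S g" "g ` S \<subseteq> T"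
  shows "smooth_on S (\<lambda>x. f (g x))"
  using assms higher_differentiable_on_compose[of S T g f] by (simp add: smooth_on_def)

lemma smooth_on_Pair:
  assumes "open S" "smooth_on S f" "smooth_on S g"
  shows "smooth_on S (\<lambda>x. (f x, g x))"
proof (rule smooth_on_cong[OF \<open>open S\<close>])
  show "smooth_on S (\<lambda>x. (f x, 0) + (0, g x))"
    by (intro smooth_on_add smooth_on_bounded_linear_comp[OF _ _ assms(2), of "\<lambda>y. (y, 0)"]
        smooth_on_bounded_linear_comp[OF _ _ assms(3), of "\<lambda>y. (0, y)"] assms(1)
        bounded_linear_Pair bounded_linear_ident bounded_linear_zero)
qed simp

lemma vector_2_eq_axis: "(vector [a, b] :: real^2) = a *\<^sub>R axis 1 1 + b *\<^sub>R axis 2 1"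
  by (simp add: vec_eq_iff forall_2 axis_def)

lemma smooth_on_vector_2:
  fixes f g :: "'a::real_normed_vector \<Rightarrow> real"
  assumes "open S" "smooth_on S f" "smooth_on S g"
  shows "smooth_on S (\<lambda>x. vector [f x, g x] :: real^2)"
  unfolding vector_2_eq_axis
  by (intro smooth_on_add smooth_on_scaleR smooth_on_const assms)

section \<open>A chart in which a given function is a coordinate\<close>

lemma open_square: "open {p :: real^2. \<bar>p $ 1\<bar> < \<epsilon> \<and> \<bar>p $ 2\<bar> < \<epsilon>}"
  by (intro open_Collect_conj open_Collect_less continuous_intros)

lemma square_subset_open:
  fixes V :: "(real^2) set"
  assumes "open V" "0 \<in> V"
  obtains \<epsilon> where "\<epsilon> > 0" "{p. \<bar>p $ 1\<bar> < \<epsilon> \<and> \<bar>p $ 2\<bar> < \<epsilon>} \<subseteq> V"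
proof -
  obtain e where e: "e > 0" "ball 0 e \<subseteq> V"
    using assms openE by blast
  have "norm p < e" if "\<bar>p $ 1\<bar> < e/2" "\<bar>p $ 2\<bar> < e/2" for p :: "real^2"
    using norm_le_l1_cart[of p] that by (simp add: sum_2)
  then show ?thesis
    using e by (intro that[of "e/2"]) auto
qed

lemma frechet_derivative_eq_partials:
  fixes f :: "real^2 \<Rightarrow> 'b::real_normed_vector"
  assumes "(f has_derivative f') (at p)"
  shows "f' v = v $ 1 *\<^sub>R partial 1 f p + v $ 2 *\<^sub>R partial 2 f p"
proof -
  have "v = v $ 1 *\<^sub>R axis 1 1 + v $ 2 *\<^sub>R axis 2 1"
    by (simp add: vec_eq_iff forall_2 axis_def)
  then have "f' v = f' (v $ 1 *\<^sub>R axis 1 1 + v $ 2 *\<^sub>R axis 2 1)"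
    by simp
  also have "\<dots> = v $ 1 *\<^sub>R f' (axis 1 1) + v $ 2 *\<^sub>R f' (axis 2 1)"
    using has_derivative_linear[OF assms] by (simp add: linear_add linear_cmul)
  finally show ?thesis
    using frechet_derivative_at[OF assms] by (simp add: partial_def)
qed

text \<open>
  The second coordinate of the inverse chart is the linear function whose gradient at \<open>0\<close> is the
  gradient of \<open>f\<close> rotated by a right angle, so that the Jacobian determinant at \<open>0\<close> is the squared
  length of that gradient. Smoothness of the local inverse \<open>g\<close> follows by bootstrapping: by Cramer's
  rule its derivative is a smooth function composed with \<open>g\<close>, hence as regular as \<open>g\<close> itself.
\<close>

lemma straightening_chart:
  fixes f :: "real^2 \<Rightarrow> real"
  assumes "open U" "0 \<in> U" "smooth_on U f" "f 0 = 0"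
    and "partial 1 f 0 \<noteq> 0 \<or> partial 2 f 0 \<noteq> 0"
  obtains \<epsilon> W \<phi> where "\<epsilon> > 0" "W \<subseteq> U"
    "diffeomorphism {p :: real^2. \<bar>p $ 1\<bar> < \<epsilon> \<and> \<bar>p $ 2\<bar> < \<epsilon>} W \<phi>" "\<phi> 0 = 0"
    "\<And>p. \<bar>p $ 1\<bar> < \<epsilon> \<Longrightarrow> \<bar>p $ 2\<bar> < \<epsilon> \<Longrightarrow> f (\<phi> p) = p $ 1"
proof -
  define a where "a = partial 1 f 0"
  define b where "b = partial 2 f 0"
  define \<delta> where "\<delta> p = partial 1 f p * a + partial 2 f p * b" for p
  define U0 where "U0 = {p \<in> U. \<delta> p > 0}"
  have smooth_\<delta>: "smooth_on U \<delta>"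
    unfolding \<delta>_def by (intro smooth_on_add smooth_on_mult smooth_on_const smooth_on_partial assms)
  have "open U0"
    unfolding U0_def
    using continuous_open_preimage[OF smooth_on_continuous_on[OF smooth_\<delta>] \<open>open U\<close>, of "{0<..}"]
    by (simp add: Collect_conj_eq vimage_def)
  have "\<delta> 0 > 0"
    using assms(5) unfolding \<delta>_def a_def b_def
    by (metis add_pos_nonneg add_nonneg_pos not_real_square_gt_zero zero_le_square)
  then have "0 \<in> U0" "U0 \<subseteq> U"
    using assms(2) by (auto simp: U0_def)
  define \<Psi> :: "real^2 \<Rightarrow> real^2" where "\<Psi> p = vector [f p, a * p $ 2 - b * p $ 1]" for p
  have smooth_\<Psi>: "smooth_on U \<Psi>"
  proof -
    have "bounded_linear (\<lambda>p :: real^2. a * p $ 2 - b * p $ 1)"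
      by (intro bounded_linear_sub bounded_linear_mult_right[THEN bounded_linear_compose] bounded_linear_vec_nth)
    then show ?thesis
      unfolding \<Psi>_def by (intro smooth_on_vector_2 smooth_on_bounded_linear assms)
  qed
  \<comment> \<open>\<open>D p\<close> is the derivative of \<open>\<Psi>\<close>, with determinant \<open>\<delta> p\<close>, and \<open>I p\<close> its inverse by Cramer's rule.\<close>
  define D :: "real^2 \<Rightarrow> real^2 \<Rightarrow> real^2"
    where "D p v = vector [v $ 1 * partial 1 f p + v $ 2 * partial 2 f p, a * v $ 2 - b * v $ 1]" for p v
  define I :: "real^2 \<Rightarrow> real^2 \<Rightarrow> real^2"
    where "I p w = vector [(a * w $ 1 - partial 2 f p * w $ 2) / \<delta> p, (b * w $ 1 + partial 1 f p * w $ 2) / \<delta> p]"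
    for p w
  have D: "(\<Psi> has_derivative D p) (at p)" if "p \<in> U" for p
  proof -
    have "(f has_derivative (\<lambda>v. v $ 1 * partial 1 f p + v $ 2 * partial 2 f p)) (at p)"
      by (rule has_derivative_eq_rhs[OF smooth_on_has_derivative[OF assms(3) that]])
        (simp add: fun_eq_iff frechet_derivative_eq_partials[OF smooth_on_has_derivative[OF assms(3) that]])
    then show ?thesis
      unfolding \<Psi>_def D_def vector_2_eq_axis
      by (auto intro!: derivative_eq_intros bounded_linear_imp_has_derivative[OF bounded_linear_vec_nth])
  qed
  have blin: "bounded_linear (D p)" if "p \<in> U" for p
    using D[OF that] by (rule has_derivative_bounded_linear)
  have ID: "I p (D p v) = v" "D p (I p w) = w" if "p \<in> U0" for p v w
  proof -
    have "\<delta> p \<noteq> 0"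
      using that by (simp add: U0_def)
    then show "I p (D p v) = v" "D p (I p w) = w"
      by (simp_all add: I_def D_def vec_eq_iff forall_2 field_simps) (simp_all add: \<delta>_def algebra_simps)
  qed
  have smooth_I: "smooth_on U0 (\<lambda>p. I p w)" for w
    unfolding I_def diff_conv_add_uminus
    by (intro smooth_on_vector_2 smooth_on_divide smooth_on_add smooth_on_minus smooth_on_mult
        smooth_on_const smooth_on_subset[OF smooth_on_partial[OF assms(3)] \<open>U0 \<subseteq> U\<close>]
        smooth_on_subset[OF smooth_\<delta> \<open>U0 \<subseteq> U\<close>] \<open>open U0\<close>) (simp_all add: U0_def)
  have blin_I: "bounded_linear (I p)" for p
    unfolding I_def vector_2_eq_axis
    by (intro linear_conv_bounded_linear[THEN iffD1] linearI)
      (simp_all add: algebra_simps add_divide_distrib diff_divide_distrib)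
  have cont: "continuous_on U0 (\<lambda>p. Blinfun (D p))"
  proof (rule continuous_on_blinfun_componentwise)
    fix i :: "real^2"
    have "continuous_on U0 (\<lambda>p. frechet_derivative \<Psi> (at p) i)"
      by (rule smooth_on_continuous_on[OF smooth_on_subset[OF smooth_on_frechet_derivative[OF smooth_\<Psi>] \<open>U0 \<subseteq> U\<close>]])
    then show "continuous_on U0 (\<lambda>p. blinfun_apply (Blinfun (D p)) i)"
      by (rule continuous_on_eq)
        (use \<open>U0 \<subseteq> U\<close> in \<open>auto simp: bounded_linear_Blinfun_apply blin frechet_derivative_at[OF D, symmetric]\<close>)
  qed
  have inv0: "Blinfun (I 0) o\<^sub>L Blinfun (D 0) = id_blinfun"
    using \<open>0 \<in> U0\<close> \<open>0 \<in> U\<close>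
    by (intro blinfun_eqI) (simp add: bounded_linear_Blinfun_apply blin blin_I ID)
  obtain U' V g g' where UV: "open U'" "U' \<subseteq> U0" "0 \<in> U'" "open V" "\<Psi> 0 \<in> V" "homeomorphism U' V \<Psi> g"
    and g: "\<And>y. y \<in> V \<Longrightarrow> (g has_derivative (g' y)) (at y)"
      "\<And>y. y \<in> V \<Longrightarrow> g' y = inv (blinfun_apply (Blinfun (D (g y))))"
    by (rule inverse_function_theorem[OF \<open>open U0\<close> _ cont \<open>0 \<in> U0\<close> inv0, of \<Psi>])
      (use D \<open>U0 \<subseteq> U\<close> in \<open>auto simp: bounded_linear_Blinfun_apply blin subset_iff\<close>)
  have gV: "g y \<in> U'" "\<Psi> (g y) = y" if "y \<in> V" for y
    using UV(6) that by (auto simp: homeomorphism_def)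
  have g\<Psi>: "g (\<Psi> p) = p" if "p \<in> U'" for p
    using UV(6) that by (auto simp: homeomorphism_def)
  have Dg: "(g has_derivative I (g y)) (at y)" if "y \<in> V" for y
  proof -
    have "g y \<in> U0" "g y \<in> U"
      using gV(1)[OF that] UV(2) \<open>U0 \<subseteq> U\<close> by auto
    then have "g' y = I (g y)"
      unfolding g(2)[OF that] by (intro inv_equality) (simp_all add: bounded_linear_Blinfun_apply blin ID)
    then show ?thesis
      using g(1)[OF that] by simp
  qed
  have "higher_differentiable_on V g n" for n
  proof (induction n)
    case 0
    then show ?case
      using UV(6) by (simp add: homeomorphism_def)
  next
    case (Suc n)
    show ?case
    proof (rule higher_differentiable_on_Suc_of_derivative[OF \<open>open V\<close> Dg])
      show "higher_differentiable_on V (\<lambda>y. I (g y) w) n" for w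
        by (rule higher_differentiable_on_compose[OF \<open>open V\<close> \<open>open U0\<close> _ smooth_onD[OF smooth_I] Suc])
          (use gV(1) UV(2) in auto)
    qed
  qed
  then have smooth_g: "smooth_on V g"
    by (rule smooth_onI)
  have \<Psi>0: "\<Psi> 0 = 0"
    by (simp add: \<Psi>_def \<open>f 0 = 0\<close> vec_eq_iff forall_2)
  have "0 \<in> V"
    using UV(5) \<Psi>0 by simp
  then obtain \<epsilon> where \<epsilon>: "\<epsilon> > 0" "{p. \<bar>p $ 1\<bar> < \<epsilon> \<and> \<bar>p $ 2\<bar> < \<epsilon>} \<subseteq> V"
    by (rule square_subset_open[OF \<open>open V\<close>])
  define Q where "Q = {p :: real^2. \<bar>p $ 1\<bar> < \<epsilon> \<and> \<bar>p $ 2\<bar> < \<epsilon>}"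
  have Q: "Q \<subseteq> V" "open Q"
    using \<epsilon>(2) open_square by (auto simp: Q_def)
  have W_eq: "g ` Q = {p \<in> U'. \<Psi> p \<in> Q}"
  proof
    show "g ` Q \<subseteq> {p \<in> U'. \<Psi> p \<in> Q}"
      using Q(1) gV by auto
    show "{p \<in> U'. \<Psi> p \<in> Q} \<subseteq> g ` Q"
    proof
      fix p assume "p \<in> {p \<in> U'. \<Psi> p \<in> Q}"
      then show "p \<in> g ` Q"
        using g\<Psi>[of p] by (intro image_eqI[of _ _ "\<Psi> p"]) auto
    qed
  qed
  have "continuous_on U' \<Psi>"
    using UV(6) by (simp add: homeomorphism_def)
  then have "open (g ` Q)"
    unfolding W_eq using continuous_open_preimage[OF _ UV(1) Q(2)]
    by (simp add: Collect_conj_eq vimage_def)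
  have "inj_on g Q"
    using gV(2) Q(1) by (intro inj_on_inverseI[where g = \<Psi>]) auto
  have subU: "g ` Q \<subseteq> U"
    using W_eq UV(2) \<open>U0 \<subseteq> U\<close> by auto
  have "smooth_on (g ` Q) (inv_into Q g)"
  proof (rule smooth_on_cong[OF \<open>open (g ` Q)\<close> smooth_on_subset[OF smooth_\<Psi> subU]])
    show "\<Psi> p = inv_into Q g p" if "p \<in> g ` Q" for p
      using that gV(2) Q(1) \<open>inj_on g Q\<close> by (auto simp: subset_iff)
  qed
  then have "diffeomorphism Q (g ` Q) g"
    unfolding diffeomorphism_def
    using Q \<open>open (g ` Q)\<close> smooth_on_subset[OF smooth_g Q(1)] \<open>inj_on g Q\<close> by (simp add: bij_betw_def)
  moreover have "f (g p) = p $ 1" if "p \<in> Q" for p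
  proof -
    have "\<Psi> (g p) $ 1 = p $ 1"
      using gV(2) that Q(1) by auto
    then show ?thesis by (simp add: \<Psi>_def)
  qed
  ultimately show ?thesis
    using \<epsilon>(1) subU g\<Psi>[OF UV(3)] \<Psi>0 by (intro that[of \<epsilon> "g ` Q" g]) (simp_all add: Q_def)
qed

section \<open>Recovering a function from its partial derivatives\<close>

lemma vector_2_zero: "vector [0, 0] = (0 :: real^2)"
  by (simp add: vec_eq_iff forall_2)

lemma has_derivative_vector_2_left: "((\<lambda>t. vector [t, v] :: real^2) has_derivative (\<lambda>s. s *\<^sub>R axis 1 1)) (at t within X)"
  unfolding vector_2_eq_axis by (auto intro!: derivative_eq_intros)

lemma has_derivative_vector_2_right: "((\<lambda>t. vector [u, t] :: real^2) has_derivative (\<lambda>s. s *\<^sub>R axis 2 1)) (at t within X)"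
  unfolding vector_2_eq_axis by (auto intro!: derivative_eq_intros)

lemma has_vector_derivative_partial:
  fixes F :: "real^2 \<Rightarrow> real"
  assumes "smooth_on Q F"
  shows "vector [t, v] \<in> Q \<Longrightarrow> ((\<lambda>t. F (vector [t, v])) has_vector_derivative partial 1 F (vector [t, v])) (at t within X)"
    and "vector [u, t] \<in> Q \<Longrightarrow> ((\<lambda>t. F (vector [u, t])) has_vector_derivative partial 2 F (vector [u, t])) (at t within X)"
proof -
  note D = smooth_on_has_derivative[OF assms]
  show "((\<lambda>t. F (vector [t, v])) has_vector_derivative partial 1 F (vector [t, v])) (at t within X)"
    if "vector [t, v] \<in> Q"
    unfolding has_vector_derivative_def
    by (rule has_derivative_eq_rhs[OF has_derivative_compose[OF has_derivative_vector_2_left D[OF that]]])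
      (simp add: fun_eq_iff frechet_derivative_eq_partials[OF D[OF that]] axis_def)
  show "((\<lambda>t. F (vector [u, t])) has_vector_derivative partial 2 F (vector [u, t])) (at t within X)"
    if "vector [u, t] \<in> Q"
    unfolding has_vector_derivative_def
    by (rule has_derivative_eq_rhs[OF has_derivative_compose[OF has_derivative_vector_2_right D[OF that]]])
      (simp add: fun_eq_iff frechet_derivative_eq_partials[OF D[OF that]] axis_def)
qed

lemma LBINT_from_0_cong:
  fixes f g :: "real \<Rightarrow> real"
  assumes "\<And>t. \<bar>t\<bar> \<le> \<bar>v\<bar> \<Longrightarrow> f t = g t"
  shows "(LBINT t=0..v. f t) = (LBINT t=0..v. g t)"
  by (rule interval_integral_cong) (rule assms, auto simp: einterval_def min_def max_def zero_ereal_def split: if_splits)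

lemma LBINT_from_0_eq:
  fixes f F :: "real \<Rightarrow> real"
  assumes "continuous_on {-\<epsilon><..<\<epsilon>} f" "\<bar>v\<bar> < \<epsilon>"
    and "\<And>t. \<bar>t\<bar> < \<epsilon> \<Longrightarrow> (F has_vector_derivative f t) (at t)"
  shows "(LBINT t=0..v. f t) = F v - F 0"
  unfolding zero_ereal_def
proof (rule interval_integral_FTC_finite)
  show "continuous_on {min 0 v..max 0 v} f"
    by (rule continuous_on_subset[OF assms(1)]) (use assms(2) in auto)
  show "(F has_vector_derivative f t) (at t within {min 0 v..max 0 v})"
    if "min 0 v \<le> t" "t \<le> max 0 v" for t
    by (rule has_vector_derivative_at_within[OF assms(3)]) (use that assms(2) in auto)
qed

lemma LBINT_from_0_add:
  fixes f g :: "real \<Rightarrow> real"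
  assumes "continuous_on {-\<epsilon><..<\<epsilon>} f" "continuous_on {-\<epsilon><..<\<epsilon>} g" "\<bar>v\<bar> < \<epsilon>"
  shows "(LBINT t=0..v. f t + g t) = (LBINT t=0..v. f t) + (LBINT t=0..v. g t)"
proof -
  have "interval_lebesgue_integrable lborel 0 (ereal v) k" if "continuous_on {-\<epsilon><..<\<epsilon>} k"
    for k :: "real \<Rightarrow> real"
    unfolding zero_ereal_def
    by (rule interval_integrable_isCont)
      (use that assms(3) in \<open>auto simp: continuous_on_eq_continuous_at min_def max_def split: if_splits\<close>)
  then show ?thesis
    using assms(1,2) by (intro interval_lebesgue_integral_add)
qed

text \<open>
  The four integrals are successive applications of the fundamental theorem of calculus: the inner
  ones reconstruct \<open>g2\<close> along vertical lines and \<open>g1\<close>, \<open>g2\<close> on the axis \<open>v = 0\<close>, the outer ones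
  reconstruct \<open>c\<close> first along the axis and then vertically.
\<close>

lemma normal_form_eq_graph:
  fixes b c g1 g2 h :: "real^2 \<Rightarrow> real"
  assumes Q: "Q = {p. \<bar>p $ 1\<bar> < \<epsilon> \<and> \<bar>p $ 2\<bar> < \<epsilon>}"
    and smooth: "smooth_on Q b" "smooth_on Q c" "smooth_on Q g1" "smooth_on Q g2" "smooth_on Q h"
    and init: "c 0 = 0" "g1 0 = 0" "g2 0 = 0"
    and c1: "\<And>p. p \<in> Q \<Longrightarrow> partial 1 c p = g1 p + g2 p * partial 1 b p"
    and c2: "\<And>p. p \<in> Q \<Longrightarrow> partial 2 c p = g2 p * partial 2 b p"
    and g22: "\<And>p. p \<in> Q \<Longrightarrow> partial 2 g2 p = h p * partial 2 b p"
    and uv: "\<bar>u\<bar> < \<epsilon>" "\<bar>v\<bar> < \<epsilon>"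
  shows "normal_form b h (\<lambda>t. partial 1 g2 (vector [t, 0])) (\<lambda>t. partial 1 g1 (vector [t, 0])) u v =
    vector [u, b (vector [u, v]), c (vector [u, v])]"
proof -
  have inQ: "vector [s, t] \<in> Q" if "\<bar>s\<bar> < \<epsilon>" "\<bar>t\<bar> < \<epsilon>" for s t
    using that by (simp add: Q)
  have conts: "continuous_on {-\<epsilon><..<\<epsilon>} (\<lambda>t. F (vector [t, 0]))" if "smooth_on Q F" for F :: "real^2 \<Rightarrow> real"
    by (rule continuous_on_compose2[OF smooth_on_continuous_on[OF that]])
      (use inQ uv in \<open>auto intro!: has_derivative_continuous_on has_derivative_vector_2_left\<close>)
  have contt: "continuous_on {-\<epsilon><..<\<epsilon>} (\<lambda>t. F (vector [u, t]))" if "smooth_on Q F" for F :: "real^2 \<Rightarrow> real"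
    by (rule continuous_on_compose2[OF smooth_on_continuous_on[OF that]])
      (use inQ uv in \<open>auto intro!: has_derivative_continuous_on has_derivative_vector_2_right\<close>)
  have D1: "((\<lambda>t. F (vector [t, 0])) has_vector_derivative partial 1 F (vector [t, 0])) (at t)"
    if "smooth_on Q F" "\<bar>t\<bar> < \<epsilon>" for F :: "real^2 \<Rightarrow> real" and t
    using has_vector_derivative_partial(1)[OF that(1) inQ] that uv by simp
  have D2: "((\<lambda>t. F (vector [u, t])) has_vector_derivative partial 2 F (vector [u, t])) (at t)"
    if "smooth_on Q F" "\<bar>t\<bar> < \<epsilon>" for F :: "real^2 \<Rightarrow> real" and t
    using has_vector_derivative_partial(2)[OF that(1) inQ] that uv by simp
  have inner_h: "(LBINT t1=0..t. h (vector [u, t1]) * partial 2 b (vector [u, t1])) =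
      g2 (vector [u, t]) - g2 (vector [u, 0])" if t: "\<bar>t\<bar> < \<epsilon>" for t
  proof (rule LBINT_from_0_eq[OF _ t, where F = "\<lambda>t. g2 (vector [u, t])"])
    show "continuous_on {-\<epsilon><..<\<epsilon>} (\<lambda>t1. h (vector [u, t1]) * partial 2 b (vector [u, t1]))"
      by (intro continuous_on_mult contt smooth smooth_on_partial)
    show "((\<lambda>t. g2 (vector [u, t])) has_vector_derivative h (vector [u, s]) * partial 2 b (vector [u, s])) (at s)"
      if "\<bar>s\<bar> < \<epsilon>" for s
      using D2[OF smooth(4) that] g22 inQ that uv by simp
  qed
  have inner_l: "(LBINT t1=0..t. partial 1 g (vector [t1, 0])) = g (vector [t, 0])"
    if t: "\<bar>t\<bar> < \<epsilon>" and g: "smooth_on Q g" "g 0 = 0" for t and g :: "real^2 \<Rightarrow> real"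
    using LBINT_from_0_eq[OF conts[OF smooth_on_partial[OF g(1)]] t D1[OF g(1)]] g(2)
    by (simp add: vector_2_zero)
  have I1: "(LBINT t2=0..v. (LBINT t1=0..t2. h (vector [u, t1]) * partial 2 b (vector [u, t1]))
        * partial 2 b (vector [u, t2])) =
      (c (vector [u, v]) - g2 (vector [u, 0]) * b (vector [u, v])) -
      (c (vector [u, 0]) - g2 (vector [u, 0]) * b (vector [u, 0]))" (is "?I1 = _")
  proof -
    have "?I1 = (LBINT t2=0..v. (g2 (vector [u, t2]) - g2 (vector [u, 0])) * partial 2 b (vector [u, t2]))"
      by (rule LBINT_from_0_cong) (use inner_h uv in simp)
    also have "\<dots> = (c (vector [u, v]) - g2 (vector [u, 0]) * b (vector [u, v])) -
      (c (vector [u, 0]) - g2 (vector [u, 0]) * b (vector [u, 0]))"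
    proof (rule LBINT_from_0_eq[OF _ uv(2), where F = "\<lambda>t. c (vector [u, t]) - g2 (vector [u, 0]) * b (vector [u, t])"])
      show "continuous_on {-\<epsilon><..<\<epsilon>} (\<lambda>t2. (g2 (vector [u, t2]) - g2 (vector [u, 0])) * partial 2 b (vector [u, t2]))"
        by (intro continuous_on_mult continuous_on_diff continuous_on_const contt smooth smooth_on_partial)
      fix t assume t: "\<bar>t\<bar> < \<epsilon>"
      show "((\<lambda>t. c (vector [u, t]) - g2 (vector [u, 0]) * b (vector [u, t])) has_vector_derivative
          (g2 (vector [u, t]) - g2 (vector [u, 0])) * partial 2 b (vector [u, t])) (at t)"
        using has_vector_derivative_diff[OF D2[OF smooth(2) t]
            has_vector_derivative_mult_right[OF D2[OF smooth(1) t], of "g2 (vector [u, 0])"]]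
          c2[OF inQ[OF uv(1) t]] by (simp add: algebra_simps)
    qed
    finally show ?thesis .
  qed
  have I2: "(LBINT t2=0..v. (LBINT t1=0..u. partial 1 g2 (vector [t1, 0])) * partial 2 b (vector [u, t2])) =
      g2 (vector [u, 0]) * b (vector [u, v]) - g2 (vector [u, 0]) * b (vector [u, 0])"
    unfolding inner_l[OF uv(1) smooth(4) init(3)]
    by (rule LBINT_from_0_eq[OF _ uv(2), where F = "\<lambda>t. g2 (vector [u, 0]) * b (vector [u, t])"])
      (intro continuous_on_mult continuous_on_const contt has_vector_derivative_mult_right D2 smooth smooth_on_partial; assumption)+
  have I34: "(LBINT t2=0..u. (LBINT t1=0..t2. partial 1 g2 (vector [t1, 0])) * partial 1 b (vector [t2, 0])) +
      (LBINT t2=0..u. (LBINT t1=0..t2. partial 1 g1 (vector [t1, 0]))) = c (vector [u, 0])"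
    (is "?I3 + ?I4 = _")
  proof -
    have "?I3 = (LBINT t2=0..u. g2 (vector [t2, 0]) * partial 1 b (vector [t2, 0]))"
      by (rule LBINT_from_0_cong) (use inner_l[OF _ smooth(4) init(3)] uv in simp)
    moreover have "?I4 = (LBINT t2=0..u. g1 (vector [t2, 0]))"
      by (rule LBINT_from_0_cong) (use inner_l[OF _ smooth(3) init(2)] uv in simp)
    ultimately have "?I3 + ?I4 = (LBINT t2=0..u. g2 (vector [t2, 0]) * partial 1 b (vector [t2, 0]) + g1 (vector [t2, 0]))"
      using LBINT_from_0_add[OF continuous_on_mult[OF conts[OF smooth(4)] conts[OF smooth_on_partial[OF smooth(1)]]]
          conts[OF smooth(3)] uv(1)] by simp
    also have "\<dots> = c (vector [u, 0]) - c (vector [0, 0])"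
    proof (rule LBINT_from_0_eq[OF _ uv(1), where F = "\<lambda>t. c (vector [t, 0])"])
      show "continuous_on {-\<epsilon><..<\<epsilon>} (\<lambda>t2. g2 (vector [t2, 0]) * partial 1 b (vector [t2, 0]) + g1 (vector [t2, 0]))"
        by (intro continuous_on_mult continuous_on_add conts smooth smooth_on_partial)
      show "((\<lambda>t. c (vector [t, 0])) has_vector_derivative
          g2 (vector [t, 0]) * partial 1 b (vector [t, 0]) + g1 (vector [t, 0])) (at t)" if t: "\<bar>t\<bar> < \<epsilon>" for t
        using D1[OF smooth(2) t] c1[OF inQ[OF t]] uv by (simp add: algebra_simps)
    qed
    finally show ?thesis
      using init(1) by (simp add: vector_2_zero)
  qed
  show ?thesis
    by (simp only: normal_form_def add.assoc I1 I2 I34) simp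
qed

section \<open>Tangent moving bases and normal curvature\<close>

lemma matrix_vector_mult_columns_2:
  fixes A :: "real^2^'n"
  shows "A *v w = w $ 1 *\<^sub>R column 1 A + w $ 2 *\<^sub>R column 2 A"
  by (simp add: matrix_mult_sum sum_2 scalar_mult_eq_scaleR)

lemma matrix_inv_mult:
  assumes "invertible A"
  shows "A ** matrix_inv A = mat 1" "matrix_inv A ** A = mat 1"
  using someI_ex[OF assms[unfolded invertible_def]] by (simp_all add: matrix_inv_def)

lemma span_pair_iff: "y \<in> span {a, b} \<longleftrightarrow> (\<exists>k l. y = k *\<^sub>R a + l *\<^sub>R b)"
proof -
  have "y \<in> span {a, b} \<longleftrightarrow> (\<exists>k l. y - k *\<^sub>R a = l *\<^sub>R b)"
    by (auto simp: span_insert span_singleton)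
  then show ?thesis by (simp add: algebra_simps)
qed

lemma cross3_neq_0:
  assumes "a \<noteq> b" "independent {a, b :: real^3}"
  shows "cross3 a b \<noteq> 0"
proof
  assume "cross3 a b = 0"
  then consider "a = 0" | "b = 0" | k where "b = k *\<^sub>R a"
    using cross_eq_0 collinear_lemma by metis
  then show False
  proof cases
    case 3
    then have "b \<in> span {a}"
      by (auto simp: span_singleton)
    then show ?thesis
      using assms by (simp add: independent_insert insert_commute[of a b])
  qed (use assms dependent_zero in auto)
qed

lemma tangent_moving_basis_derivative_in_span:
  assumes "tangent_moving_basis U x \<Omega>" "smooth_on U x" "p \<in> U"
  shows "frechet_derivative x (at p) v \<in> span {column 1 (\<Omega> p), column 2 (\<Omega> p)}"
  using assms(1,3)
  by (simp add: frechet_derivative_eq_partials[OF smooth_on_has_derivative[OF assms(2,3)]]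
      tangent_moving_basis_def span_add span_scale)

lemma tangent_moving_basis_cross3_neq_0:
  "tangent_moving_basis U x \<Omega> \<Longrightarrow> p \<in> U \<Longrightarrow> cross3 (column 1 (\<Omega> p)) (column 2 (\<Omega> p)) \<noteq> 0"
  unfolding tangent_moving_basis_def by (meson cross3_neq_0)

lemma tangent_moving_basis_smooth_column:
  assumes "tangent_moving_basis U x \<Omega>" "open U"
  shows "smooth_on U (\<lambda>p. column i (\<Omega> p))"
proof (rule smooth_on_bounded_linear_comp[OF assms(2), of "column i"])
  show "bounded_linear (column i :: real^2^3 \<Rightarrow> real^3)"
    by (auto intro!: linear_conv_bounded_linear[THEN iffD1] linearI simp: column_def vec_eq_iff)
qed (use assms(1) in \<open>simp add: tangent_moving_basis_def\<close>)

lemma smooth_on_normal_field: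
  assumes "tangent_moving_basis U x \<Omega>" "open U"
  shows "smooth_on U (normal_field \<Omega>)"
  unfolding normal_field_def Let_def
  by (intro smooth_on_normalize smooth_on_cross3 tangent_moving_basis_smooth_column[OF assms] assms(2)
      tangent_moving_basis_cross3_neq_0[OF assms(1)])

text \<open>
  The derivative of \<open>x\<close> factors as \<open>D x = \<Omega> X\<close>, and \<open>\<Lambda>\<close> is the transpose of \<open>X\<close>. So at a regular point the
  substitution \<open>\<zeta> = \<Lambda>\<^sup>-\<^sup>T \<omega>\<close> describes directions by the tangent vector \<open>D x \<zeta> = \<Omega> \<omega>\<close> that they
  are mapped to; this still makes sense at singular points.
\<close>

lemma normal_curvature_in_tangent_coordinates:
  assumes "tangent_moving_basis U x \<Omega>" "smooth_on U x" "open U" "p \<in> U - singular_set U x"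
  obtains \<zeta> where "frechet_derivative x (at p) \<zeta> = \<Omega> p *v \<omega>"
    and "normal_curvature x \<Omega> p (transpose (matrix_inv (Lambda x \<Omega> p)) *v \<omega>) =
      - ((\<Omega> p *v \<omega>) \<bullet> frechet_derivative (normal_field \<Omega>) (at p) \<zeta>) / ((\<Omega> p *v \<omega>) \<bullet> (\<Omega> p *v \<omega>))"
proof -
  define J where "J = jacobian x (at p)"
  have p: "p \<in> U" "inj (frechet_derivative x (at p))"
    using assms(4) by (auto simp: singular_set_def)
  have J: "J *v v = frechet_derivative x (at p) v" for v
    using smooth_on_has_derivative[OF assms(2) p(1)]
    by (simp add: J_def jacobian_def matrix_works has_derivative_linear)
  have "\<exists>w. J *v v = \<Omega> p *v w" for v
  proof -
    obtain k l where "J *v v = k *\<^sub>R column 1 (\<Omega> p) + l *\<^sub>R column 2 (\<Omega> p)"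
      using tangent_moving_basis_derivative_in_span[OF assms(1,2) p(1), of v] by (auto simp: span_pair_iff J)
    then have "J *v v = \<Omega> p *v vector [k, l]"
      by (simp add: matrix_vector_mult_columns_2)
    then show ?thesis ..
  qed
  then obtain c where c: "\<And>v. J *v v = \<Omega> p *v c v"
    by metis
  define X :: "real^2^2" where "X = (\<chi> i j. c (axis j 1) $ i)"
  have J_eq: "J = \<Omega> p ** X"
  proof (rule matrix_eq[THEN iffD2], rule allI)
    fix v :: "real^2"
    have "J *v v = v $ 1 *\<^sub>R (J *v axis 1 1) + v $ 2 *\<^sub>R (J *v axis 2 1)"
      by (simp add: matrix_vector_mult_columns_2 axis_def)
    also have "\<dots> = \<Omega> p *v (v $ 1 *\<^sub>R c (axis 1 1) + v $ 2 *\<^sub>R c (axis 2 1))"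
      by (simp only: c matrix_vector_right_distrib matrix_vector_mult_scaleR)
    also have "v $ 1 *\<^sub>R c (axis 1 1) + v $ 2 *\<^sub>R c (axis 2 1) = X *v v"
      by (simp add: matrix_vector_mult_columns_2 X_def column_def vec_eq_iff)
    finally show "J *v v = (\<Omega> p ** X) *v v"
      by (simp add: matrix_vector_mul_assoc)
  qed
  have "w = 0" if "\<Omega> p *v w = 0" for w
  proof -
    have cr: "cross3 (column 1 (\<Omega> p)) (column 2 (\<Omega> p)) \<noteq> 0"
      by (rule tangent_moving_basis_cross3_neq_0[OF assms(1) p(1)])
    have "w $ 1 *\<^sub>R column 1 (\<Omega> p) + w $ 2 *\<^sub>R column 2 (\<Omega> p) = 0"
      using that by (simp add: matrix_vector_mult_columns_2)
    then have "cross3 (w $ 1 *\<^sub>R column 1 (\<Omega> p) + w $ 2 *\<^sub>R column 2 (\<Omega> p)) (column 2 (\<Omega> p)) = 0"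
      "cross3 (column 1 (\<Omega> p)) (w $ 1 *\<^sub>R column 1 (\<Omega> p) + w $ 2 *\<^sub>R column 2 (\<Omega> p)) = 0"
      by simp_all
    then show ?thesis
      using cr by (simp add: cross_add_left cross_add_right cross_mult_left cross_mult_right vec_eq_iff forall_2) blast
  qed
  \<comment> \<open>Hence the Gram matrix occurring in \<open>\<Lambda>\<close> is invertible.\<close>
  then have "w = 0" if "(transpose (\<Omega> p) ** \<Omega> p) *v w = 0" for w
  proof -
    have "(\<Omega> p *v w) \<bullet> (\<Omega> p *v w) = w \<bullet> ((transpose (\<Omega> p) ** \<Omega> p) *v w)"
      by (simp add: dot_lmul_matrix[symmetric] matrix_vector_mul_assoc[symmetric] inner_commute)
    then show ?thesis
      using that \<open>\<And>w. \<Omega> p *v w = 0 \<Longrightarrow> w = 0\<close> by simp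
  qed
  then have inv_Gram: "invertible (transpose (\<Omega> p) ** \<Omega> p)"
    using invertible_left_inverse matrix_left_invertible_ker by metis
  have "Lambda x \<Omega> p = transpose X ** ((transpose (\<Omega> p) ** \<Omega> p) ** matrix_inv (transpose (\<Omega> p) ** \<Omega> p))"
    unfolding Lambda_def J_def[symmetric] J_eq by (simp add: matrix_transpose_mul matrix_mul_assoc)
  also have "\<dots> = transpose X"
    using matrix_inv_mult(1)[OF inv_Gram] by simp
  finally have Lam: "Lambda x \<Omega> p = transpose X" .
  have "v = 0" if "X *v v = 0" for v
  proof -
    have "J *v v = J *v 0"
      using that by (simp add: J_eq flip: matrix_vector_mul_assoc)
    then show ?thesis
      using p(2) by (simp only: J inj_eq)
  qed
  then have "invertible X"
    using invertible_left_inverse matrix_left_invertible_ker by metis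
  then have "matrix_inv (transpose X) ** transpose X = mat 1"
    by (intro matrix_inv_mult(2) transpose_invertible)
  then have X_inv: "X ** transpose (matrix_inv (transpose X)) = mat 1"
    by (metis matrix_transpose_mul transpose_mat transpose_transpose)
  define \<zeta> where "\<zeta> = transpose (matrix_inv (Lambda x \<Omega> p)) *v \<omega>"
  have "X *v \<zeta> = \<omega>"
    unfolding \<zeta>_def Lam by (simp only: matrix_vector_mul_assoc X_inv matrix_vector_mul_lid)
  then have J\<zeta>: "J *v \<zeta> = \<Omega> p *v \<omega>"
    by (simp add: J_eq flip: matrix_vector_mul_assoc)
  have n: "jacobian (normal_field \<Omega>) (at p) *v \<zeta> = frechet_derivative (normal_field \<Omega>) (at p) \<zeta>"
    using smooth_on_has_derivative[OF smooth_on_normal_field[OF assms(1,3)] p(1)]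
    by (simp add: jacobian_def matrix_works has_derivative_linear)
  have I: "\<zeta> \<bullet> ((transpose J ** B) *v \<zeta>) = (J *v \<zeta>) \<bullet> (B *v \<zeta>)" for B
    by (simp add: inner_commute[of \<zeta>] dot_lmul_matrix inner_commute[of "J *v \<zeta>"] flip: matrix_vector_mul_assoc)
  have neg: "(- B) *v \<zeta> = - (B *v \<zeta>)" for B :: "real^2^2"
    by (simp add: matrix_vector_mult_columns_2 column_def vec_eq_iff)
  have "normal_curvature x \<Omega> p \<zeta> =
      - ((\<Omega> p *v \<omega>) \<bullet> frechet_derivative (normal_field \<Omega>) (at p) \<zeta>) / ((\<Omega> p *v \<omega>) \<bullet> (\<Omega> p *v \<omega>))"
    unfolding normal_curvature_def second_form_def first_form_def J_def[symmetric] neg inner_minus_right I n J\<zeta> ..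
  then show ?thesis
    using J\<zeta> by (intro that[of \<zeta>]) (simp_all add: J \<zeta>_def)
qed

section \<open>Frontals as graphs over an orthonormal frame\<close>

lemma cross3_inner_cross3:
  "cross3 a b \<bullet> cross3 c d = (a \<bullet> c) * (b \<bullet> d) - (a \<bullet> d) * (b \<bullet> c)"
  by (simp add: cross3_simps)

lemma inner_cross3_rotate: "a \<bullet> cross3 b c = b \<bullet> cross3 c a"
  by (simp add: cross3_simps)

text \<open>The letters \<open>t\<close> and \<open>n\<close> stand for a unit tangent and a unit normal vector.\<close>

locale orthonormal_pair =
  fixes t n :: "real^3"
  assumes unit_t: "t \<bullet> t = 1" and unit_n: "n \<bullet> n = 1" and orthogonal_tn: "t \<bullet> n = 0"
begin

definition s :: "real^3" where "s = cross3 n t"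

definition frame :: "real^3^3" where "frame = vector [t, s, n]"

lemma orthonormal_s: "s \<bullet> s = 1" "t \<bullet> s = 0" "s \<bullet> n = 0"
  using unit_t unit_n orthogonal_tn
  by (simp_all add: s_def cross3_inner_cross3 dot_cross_self inner_commute)

lemma frame_mult: "frame *v y = vector [t \<bullet> y, s \<bullet> y, n \<bullet> y]"
  by (simp add: vec_eq_iff forall_3 frame_def matrix_vector_mul_component)

lemma orthogonal_frame: "orthogonal_matrix frame"
  unfolding orthogonal_matrix_orthonormal_rows
  using unit_t unit_n orthogonal_tn orthonormal_s
  by (simp add: forall_3 row_def frame_def norm_eq_1 orthogonal_def inner_commute vec_nth_inverse)

lemma rotation_frame: "rotation_matrix frame"
proof -
  have "det frame = t \<bullet> cross3 s n"
    by (simp add: frame_def dot_cross_det)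
  also have "\<dots> = cross3 n t \<bullet> s"
    by (simp add: inner_cross3_rotate[of t s n] inner_commute)
  finally show ?thesis
    using orthogonal_frame orthonormal_s by (simp add: rotation_matrix_def s_def)
qed

lemma inner_in_frame: "y \<bullet> z = (t \<bullet> y) * (t \<bullet> z) + (s \<bullet> y) * (s \<bullet> z) + (n \<bullet> y) * (n \<bullet> z)"
proof -
  have "orthogonal_transformation ((*v) frame)"
    using orthogonal_frame by (simp add: orthogonal_transformation_matrix)
  then have "y \<bullet> z = (frame *v y) \<bullet> (frame *v z)"
    by (simp add: orthogonal_transformation_def)
  then show ?thesis
    by (simp add: frame_mult inner_vec_def sum_3)
qed

lemma eq_in_frame:
  assumes "t \<bullet> y = t \<bullet> z" "s \<bullet> y = s \<bullet> z" "n \<bullet> y = n \<bullet> z"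
  shows "y = z"
proof -
  have "(y - z) \<bullet> (y - z) = 0"
    using assms by (subst inner_in_frame) (simp add: inner_diff_right)
  then show ?thesis by simp
qed

end

text \<open>
  Write \<open>X\<close>, \<open>Y\<close>, \<open>Z\<close> for the coordinates with respect to \<open>t\<close>, \<open>s\<close>, \<open>n\<close>. By the
  assumption \<open>transversal\<close> no plane spanned by the moving basis is vertical, so these planes are
  \<open>Z = slope1 * X + slope2 * Y\<close>. The slopes are smooth substitutes, available also at singular points,
  for the derivatives of \<open>Z\<close> with respect to \<open>X\<close> and \<open>Y\<close>. The vector \<open>tangent2\<close>
  is the one in such a plane lying over the \<open>Y\<close>-direction, and \<open>coords2\<close> are its coordinates in
  the moving basis, found by Cramer's rule.
\<close>

locale adapted_frame = orthonormal_pair +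
  fixes U :: "(real^2) set" and x :: "real^2 \<Rightarrow> real^3" and \<Omega> :: "real^2 \<Rightarrow> real^2^3"
  assumes open_U: "open U" and smooth_x: "smooth_on U x" and tmb: "tangent_moving_basis U x \<Omega>"
    and transversal: "p \<in> U \<Longrightarrow> cross3 (column 1 (\<Omega> p)) (column 2 (\<Omega> p)) \<bullet> n > 0"
begin

definition w :: "real^2 \<Rightarrow> real^3" where "w p = cross3 (column 1 (\<Omega> p)) (column 2 (\<Omega> p))"
definition slope1 :: "real^2 \<Rightarrow> real" where "slope1 p = - (w p \<bullet> t) / (w p \<bullet> n)"
definition slope2 :: "real^2 \<Rightarrow> real" where "slope2 p = - (w p \<bullet> s) / (w p \<bullet> n)"
definition tangent2 :: "real^2 \<Rightarrow> real^3" where "tangent2 p = s + slope2 p *\<^sub>R n"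
definition coords2 :: "real^2 \<Rightarrow> real^2" where
  "coords2 p = vector [- (column 2 (\<Omega> p) \<bullet> t) / (w p \<bullet> n), (column 1 (\<Omega> p) \<bullet> t) / (w p \<bullet> n)]"

lemma w_pos: "p \<in> U \<Longrightarrow> w p \<bullet> n > 0"
  by (simp add: w_def transversal)

lemma smooth_w: "smooth_on U w"
  unfolding w_def by (intro smooth_on_cross3 tangent_moving_basis_smooth_column[OF tmb] open_U)

lemma smooth_slope1: "smooth_on U slope1" and smooth_slope2: "smooth_on U slope2"
  and smooth_coords2: "smooth_on U coords2"
  unfolding slope1_def slope2_def coords2_def
  by (intro smooth_on_vector_2 smooth_on_divide smooth_on_minus smooth_on_inner smooth_w smooth_on_const
      tangent_moving_basis_smooth_column[OF tmb] w_pos open_U; assumption)+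

lemma smooth_tangent2: "smooth_on U tangent2"
  unfolding tangent2_def by (intro smooth_on_add smooth_on_scaleR smooth_on_const smooth_slope2 open_U)

text \<open>The vector \<open>w\<close> is orthogonal to every tangent vector; solve for the component along \<open>n\<close>.\<close>

lemma derivative_in_frame:
  assumes "p \<in> U"
  shows "n \<bullet> frechet_derivative x (at p) v =
    slope1 p * (t \<bullet> frechet_derivative x (at p) v) + slope2 p * (s \<bullet> frechet_derivative x (at p) v)"
proof -
  define y where "y = frechet_derivative x (at p) v"
  have "w p \<bullet> y = 0"
    using tangent_moving_basis_derivative_in_span[OF tmb smooth_x assms, of v]
    by (auto simp: span_pair_iff w_def y_def inner_add_right dot_cross_self)
  then have "(w p \<bullet> t) * (t \<bullet> y) + (w p \<bullet> s) * (s \<bullet> y) + (w p \<bullet> n) * (n \<bullet> y) = 0"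
    using inner_in_frame[of "w p" y] by (simp add: inner_commute)
  then show ?thesis
    using w_pos[OF assms] by (simp add: slope1_def slope2_def field_simps flip: y_def)
qed

lemma tangent2_in_frame: "t \<bullet> tangent2 p = 0" "s \<bullet> tangent2 p = 1" "n \<bullet> tangent2 p = slope2 p"
  using unit_n orthogonal_tn orthonormal_s
  by (simp_all add: tangent2_def inner_add_right inner_commute)

text \<open>
  Both sides equal \<open>w \<times> t\<close> divided by \<open>w \<bullet> n\<close>: the left one by the expansion of the double cross
  product, the right one by comparing components in the frame.
\<close>

lemma tangent2_eq:
  assumes "p \<in> U"
  shows "\<Omega> p *v coords2 p = tangent2 p"
proof -
  have pos: "w p \<bullet> n \<noteq> 0"
    using w_pos[OF assms] by simp
  have "(w p \<bullet> n) *\<^sub>R (\<Omega> p *v coords2 p) = (column 1 (\<Omega> p) \<bullet> t) *\<^sub>R column 2 (\<Omega> p) - (column 2 (\<Omega> p) \<bullet> t) *\<^sub>R column 1 (\<Omega> p)"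
    using pos by (simp add: matrix_vector_mult_columns_2 coords2_def algebra_simps)
  also have "\<dots> = cross3 (w p) t"
    by (simp add: w_def cross_skew[of "cross3 _ _" t] Lagrange inner_commute)
  finally have eq: "(w p \<bullet> n) *\<^sub>R (\<Omega> p *v coords2 p) = cross3 (w p) t" .
  have "s \<bullet> cross3 (w p) t = w p \<bullet> n"
    using unit_t orthogonal_tn by (simp add: s_def cross3_inner_cross3 inner_commute)
  moreover have "n \<bullet> cross3 (w p) t = - (w p \<bullet> s)"
    using inner_cross3_rotate[of n "w p" t] by (simp add: s_def cross_skew[of t n])
  ultimately have "cross3 (w p) t = (w p \<bullet> n) *\<^sub>R tangent2 p"
    using pos by (intro eq_in_frame) (simp_all add: dot_cross_self tangent2_in_frame slope2_def)
  then show ?thesis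
    using eq pos by simp
qed

lemma normal_field_eq: "normal_field \<Omega> p = (1 / norm (w p)) *\<^sub>R w p"
  by (simp add: normal_field_def w_def Let_def)

lemma normal_field_pos: "p \<in> U \<Longrightarrow> n \<bullet> normal_field \<Omega> p > 0"
  using w_pos[of p] by (auto simp: normal_field_eq inner_commute intro!: divide_pos_pos)

lemma tangent2_normal:
  assumes "p \<in> U"
  shows "tangent2 p \<bullet> normal_field \<Omega> p = 0"
proof -
  have "tangent2 p \<bullet> w p = 0"
    using tangent2_eq[OF assms]
    by (simp add: w_def matrix_vector_mult_columns_2 inner_add_left dot_cross_self flip: tangent2_eq[OF assms])
  then show ?thesis by (simp add: normal_field_eq)
qed

text \<open>
  Differentiating \<open>tangent2 \<bullet> N = 0\<close> for the normal field \<open>N\<close> trades the derivative of the normal,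
  which is what the curvature contains, for the derivative of the slope.
\<close>

lemma slope2_derivative:
  assumes "p \<in> U"
  shows "frechet_derivative slope2 (at p) v * (n \<bullet> normal_field \<Omega> p) =
    - (tangent2 p \<bullet> frechet_derivative (normal_field \<Omega>) (at p) v)"
proof -
  note D = smooth_on_has_derivative[OF smooth_slope2 assms]
    smooth_on_has_derivative[OF smooth_on_normal_field[OF tmb open_U] assms]
  have T: "(tangent2 has_derivative (\<lambda>v. frechet_derivative slope2 (at p) v *\<^sub>R n)) (at p)"
    unfolding tangent2_def[abs_def] by (auto intro!: derivative_eq_intros D)
  have "((\<lambda>q. tangent2 q \<bullet> normal_field \<Omega> q) has_derivative (\<lambda>v. 0)) (at p)"
    by (rule has_derivative_transform_within_open[OF has_derivative_const[of 0] open_U assms])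
      (simp add: tangent2_normal)
  from fun_cong[OF has_derivative_unique[OF has_derivative_inner[OF T D(2)] this], of v]
  show ?thesis
    by simp
qed

text \<open>
  The right-hand side is expressed by the normal curvature in the direction \<open>tangent2\<close>, so
  it has a smooth extension whenever the curvature is extendable.
\<close>

lemma slope2_derivative_regular:
  assumes "p \<in> U - singular_set U x"
  obtains \<zeta> where "frechet_derivative x (at p) \<zeta> = tangent2 p"
    and "frechet_derivative slope2 (at p) \<zeta> =
      normal_curvature x \<Omega> p (transpose (matrix_inv (Lambda x \<Omega> p)) *v coords2 p) *
        (tangent2 p \<bullet> tangent2 p) / (n \<bullet> normal_field \<Omega> p)"
proof -
  have p: "p \<in> U"
    using assms by simp
  obtain \<zeta> where \<zeta>: "frechet_derivative x (at p) \<zeta> = tangent2 p"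
    "normal_curvature x \<Omega> p (transpose (matrix_inv (Lambda x \<Omega> p)) *v coords2 p) =
      - (tangent2 p \<bullet> frechet_derivative (normal_field \<Omega>) (at p) \<zeta>) / (tangent2 p \<bullet> tangent2 p)"
    using normal_curvature_in_tangent_coordinates[OF tmb smooth_x open_U assms, of "coords2 p"]
    by (metis tangent2_eq[OF p])
  have "tangent2 p \<bullet> tangent2 p \<noteq> 0"
    using tangent2_in_frame(2)[of p] by auto
  then have "normal_curvature x \<Omega> p (transpose (matrix_inv (Lambda x \<Omega> p)) *v coords2 p) * (tangent2 p \<bullet> tangent2 p)
      = frechet_derivative slope2 (at p) \<zeta> * (n \<bullet> normal_field \<Omega> p)"
    unfolding \<zeta>(2) slope2_derivative[OF p] by simp
  then show ?thesis
    using normal_field_pos[OF p] by (intro that[OF \<zeta>(1)]) simp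
qed

lemma coords2_neq_0: "p \<in> U \<Longrightarrow> coords2 p \<noteq> 0"
  using tangent2_eq[of p] tangent2_in_frame(2)[of p] by auto

end

text \<open>A nonempty open set of failures would have open image inside the singular set.\<close>

lemma eq_off_singular_set_imp_eq:
  fixes F G :: "'a::real_normed_vector \<Rightarrow> real"
  assumes "diffeomorphism Q W \<phi>" "interior S = {}"
    and "continuous_on Q F" "continuous_on Q G"
    and "\<And>p. p \<in> Q \<Longrightarrow> \<phi> p \<notin> S \<Longrightarrow> F p = G p" and "p \<in> Q"
  shows "F p = G p"
proof (rule ccontr)
  have \<phi>: "open Q" "open W" "bij_betw \<phi> Q W" "continuous_on W (inv_into Q \<phi>)"
    using assms(1) by (auto simp: diffeomorphism_def intro: smooth_on_continuous_on)
  define B where "B = {p \<in> Q. F p - G p \<noteq> 0}"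
  assume "F p \<noteq> G p"
  then have "p \<in> B"
    using assms(6) by (simp add: B_def)
  have "B = Q \<inter> (\<lambda>p. F p - G p) -` (- {0})"
    by (auto simp: B_def)
  then have "open B"
    using continuous_open_preimage[OF continuous_on_diff[OF assms(3,4)] \<phi>(1) open_Compl[OF closed_singleton]]
    by simp
  have "\<phi> ` B = W \<inter> inv_into Q \<phi> -` B"
  proof
    show "\<phi> ` B \<subseteq> W \<inter> inv_into Q \<phi> -` B"
      using \<phi>(3) by (auto simp: B_def bij_betw_def)
    show "W \<inter> inv_into Q \<phi> -` B \<subseteq> \<phi> ` B"
    proof
      fix q assume "q \<in> W \<inter> inv_into Q \<phi> -` B"
      then show "q \<in> \<phi> ` B"
        using \<phi>(3) by (intro image_eqI[of _ _ "inv_into Q \<phi> q"]) (auto simp: bij_betw_def f_inv_into_f)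
    qed
  qed
  then have "open (\<phi> ` B)"
    using continuous_open_preimage[OF \<phi>(4,2) \<open>open B\<close>] by simp
  moreover have "\<phi> ` B \<subseteq> S"
    using assms(5) by (auto simp: B_def)
  ultimately show False
    using interior_maximal assms(2) \<open>p \<in> B\<close> by blast
qed

lemma rank_1_imp_partial_neq_0:
  fixes x :: "real^2 \<Rightarrow> real^3"
  assumes "x differentiable (at p)" "rank (jacobian x (at p)) = 1"
  shows "\<exists>i. partial i x p \<noteq> 0"
proof (rule ccontr)
  assume "\<not> ?thesis"
  then have "frechet_derivative x (at p) v = 0" for v
    using frechet_derivative_eq_partials assms(1)[unfolded frechet_derivative_works] by (metis add_0 scaleR_zero_right)
  then have "jacobian x (at p) = 0"
    by (simp add: jacobian_def matrix_def vec_eq_iff)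
  then show False
    using assms(2) by simp
qed

theorem theorem3p2:
  fixes U :: "(real^2) set" and x :: "real^2 \<Rightarrow> real^3"
  assumes "open U" and "0 \<in> U" and "x 0 = 0"
    and "proper_frontal U x"
    and "extendable_normal_curvature U x"
    and "rank (jacobian x (at 0)) = 1"
  shows "\<exists>T \<phi> W \<epsilon> (b :: real^2 \<Rightarrow> real) (h :: real^2 \<Rightarrow> real) (l :: real \<Rightarrow> real) (r :: real \<Rightarrow> real).
           rigid_motion T \<and> \<epsilon> > 0 \<and>
           W \<subseteq> U \<and> diffeomorphism {p :: real^2. \<bar>p $ 1\<bar> < \<epsilon> \<and> \<bar>p $ 2\<bar> < \<epsilon>} W \<phi> \<and> \<phi> 0 = 0 \<and>
           smooth_on {p. \<bar>p $ 1\<bar> < \<epsilon> \<and> \<bar>p $ 2\<bar> < \<epsilon>} b \<and>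
           smooth_on {p. \<bar>p $ 1\<bar> < \<epsilon> \<and> \<bar>p $ 2\<bar> < \<epsilon>} h \<and>
           smooth_on {-\<epsilon><..<\<epsilon>} l \<and> smooth_on {-\<epsilon><..<\<epsilon>} r \<and>
           (\<forall>u v. \<bar>u\<bar> < \<epsilon> \<longrightarrow> \<bar>v\<bar> < \<epsilon> \<longrightarrow>
              T (x (\<phi> (vector [u, v]))) = normal_form b h l r u v)"
proof -
  have smooth_xU: "smooth_on U x" and no_interior: "interior (singular_set U x) = {}"
    using assms(4) by (auto simp: proper_frontal_def frontal_def)
  obtain \<Omega> K where tmbU: "tangent_moving_basis U x \<Omega>" and smooth_K: "smooth_on (U \<times> (- {0})) K"
    and K: "\<And>p \<omega>. p \<in> U - singular_set U x \<Longrightarrow> \<omega> \<noteq> 0 \<Longrightarrow>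
      K (p, \<omega>) = normal_curvature x \<Omega> p (transpose (matrix_inv (Lambda x \<Omega> p)) *v \<omega>)"
    using assms(5) by (auto simp: extendable_normal_curvature_def)
  obtain i where i: "partial i x 0 \<noteq> 0"
    using rank_1_imp_partial_neq_0[OF _ assms(6)] smooth_on_has_derivative[OF smooth_xU assms(2)]
    by (auto simp: differentiable_def)
  define t where "t = (1 / norm (partial i x 0)) *\<^sub>R partial i x 0"
  define w0 where "w0 = cross3 (column 1 (\<Omega> 0)) (column 2 (\<Omega> 0))"
  define n where "n = (1 / norm w0) *\<^sub>R w0"
  have w0: "w0 \<noteq> 0"
    using tangent_moving_basis_cross3_neq_0[OF tmbU assms(2)] by (simp add: w0_def)
  have "partial i x 0 \<bullet> w0 = 0"
    using tangent_moving_basis_derivative_in_span[OF tmbU smooth_xU assms(2), of "axis i 1"]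
    by (auto simp: span_pair_iff w0_def partial_def inner_add_left dot_cross_self)
  then interpret orthonormal_pair t n
    using i w0 by unfold_locales (simp_all add: t_def n_def dot_square_norm power2_eq_square)
  \<comment> \<open>On this part of \<open>U\<close> the tangent planes are graphs over the one at \<open>0\<close>.\<close>
  define U1 where "U1 = {p \<in> U. cross3 (column 1 (\<Omega> p)) (column 2 (\<Omega> p)) \<bullet> n > 0}"
  have "smooth_on U (\<lambda>p. cross3 (column 1 (\<Omega> p)) (column 2 (\<Omega> p)) \<bullet> n)"
    by (intro smooth_on_inner smooth_on_cross3 smooth_on_const tangent_moving_basis_smooth_column[OF tmbU] assms(1))
  from continuous_open_preimage[OF smooth_on_continuous_on[OF this] assms(1), of "{0<..}"]
  have "open U1"
    by (simp add: U1_def Collect_conj_eq vimage_def)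
  have "U1 \<subseteq> U" "0 \<in> U1"
    using assms(2) w0 by (auto simp: U1_def n_def simp flip: w0_def)
  interpret adapted_frame t n U1 x \<Omega>
    using \<open>open U1\<close> smooth_on_subset[OF smooth_xU \<open>U1 \<subseteq> U\<close>] tmbU \<open>U1 \<subseteq> U\<close>
    by unfold_locales (auto simp: U1_def tangent_moving_basis_def intro: smooth_on_subset)
  have singular: "\<And>p. p \<in> U1 \<Longrightarrow> p \<notin> singular_set U x \<Longrightarrow> p \<in> U1 - singular_set U1 x"
    using \<open>U1 \<subseteq> U\<close> by (auto simp: singular_set_def)

  \<comment> \<open>The component along \<open>t\<close> becomes the first coordinate.\<close>
  define f where "f p = t \<bullet> x p" for p
  have f: "smooth_on U1 f"
    unfolding f_def by (intro smooth_on_inner smooth_on_const smooth_x open_U)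
  have "partial i f 0 = t \<bullet> partial i x 0"
  proof -
    have "(f has_derivative (\<lambda>v. t \<bullet> frechet_derivative x (at 0) v)) (at 0)"
      unfolding f_def by (rule has_derivative_inner_right[OF smooth_on_has_derivative[OF smooth_x \<open>0 \<in> U1\<close>]])
    from frechet_derivative_at[OF this] show ?thesis
      by (metis partial_def)
  qed
  then have "partial i f 0 \<noteq> 0"
    using i by (simp add: t_def)
  then have "partial 1 f 0 \<noteq> 0 \<or> partial 2 f 0 \<noteq> 0"
    using exhaust_2[of i] by auto
  then obtain \<epsilon> W \<phi> where \<epsilon>: "\<epsilon> > 0" and W: "W \<subseteq> U1"
    and diffeo: "diffeomorphism {p :: real^2. \<bar>p $ 1\<bar> < \<epsilon> \<and> \<bar>p $ 2\<bar> < \<epsilon>} W \<phi>" and \<phi>0: "\<phi> 0 = 0"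
    and f\<phi>: "\<And>p. \<bar>p $ 1\<bar> < \<epsilon> \<Longrightarrow> \<bar>p $ 2\<bar> < \<epsilon> \<Longrightarrow> f (\<phi> p) = p $ 1"
    using straightening_chart[OF open_U \<open>0 \<in> U1\<close> f] assms(3) by (auto simp: f_def)
  define Q where "Q = {p :: real^2. \<bar>p $ 1\<bar> < \<epsilon> \<and> \<bar>p $ 2\<bar> < \<epsilon>}"
  have diffeoQ: "diffeomorphism Q W \<phi>"
    using diffeo by (simp add: Q_def)
  then have Q: "open Q" "smooth_on Q \<phi>" "\<And>p. p \<in> Q \<Longrightarrow> \<phi> p \<in> U1"
    using W by (auto simp: diffeomorphism_def bij_betw_def)
  have comp: "smooth_on Q (\<lambda>p. F (\<phi> p))" if "smooth_on U1 F" for F :: "real^2 \<Rightarrow> 'c::real_normed_vector"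
    by (rule smooth_on_compose[OF Q(1) open_U that Q(2)]) (use Q(3) in auto)

  define b where "b p = s \<bullet> x (\<phi> p)" for p
  define c where "c p = n \<bullet> x (\<phi> p)" for p
  define H where "H q = K (q, coords2 q) * (tangent2 q \<bullet> tangent2 q) / (n \<bullet> normal_field \<Omega> q)" for q
  define l where "l u = partial 1 (\<lambda>p. slope2 (\<phi> p)) (vector [u, 0])" for u
  define r where "r u = partial 1 (\<lambda>p. slope1 (\<phi> p)) (vector [u, 0])" for u
  have "smooth_on U1 (\<lambda>q. K (q, coords2 q))"
  proof (rule smooth_on_compose[OF open_U _ smooth_K])
    show "open (U \<times> (- {0 :: real^2}))"
      by (intro open_Times assms(1) open_Compl closed_singleton)
    show "smooth_on U1 (\<lambda>q. (q, coords2 q))"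
      by (intro smooth_on_Pair smooth_coords2 open_U smooth_on_bounded_linear bounded_linear_ident)
    show "(\<lambda>q. (q, coords2 q)) ` U1 \<subseteq> U \<times> - {0}"
      using \<open>U1 \<subseteq> U\<close> coords2_neq_0 by auto
  qed
  then have smooth_H: "smooth_on U1 H"
    unfolding H_def
    by (intro smooth_on_divide smooth_on_mult smooth_on_inner smooth_tangent2 smooth_on_const
        smooth_on_normal_field[OF tmb] open_U normal_field_pos)
  have smooth_b: "smooth_on Q b" and smooth_c: "smooth_on Q c"
    unfolding b_def c_def by (intro smooth_on_inner smooth_on_const comp smooth_x Q(1))+

  define d where "d j p = frechet_derivative x (at (\<phi> p)) (partial j \<phi> p)" for j p
  have partial_comp: "partial j (\<lambda>p. F (\<phi> p)) p = frechet_derivative F (at (\<phi> p)) (partial j \<phi> p)"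
    if "smooth_on U1 F" "p \<in> Q" for F :: "real^2 \<Rightarrow> real" and j p
    using frechet_derivative_at[OF has_derivative_compose[OF smooth_on_has_derivative[OF Q(2) that(2)]
      smooth_on_has_derivative[OF that(1) Q(3)[OF that(2)]]]]
    by (metis partial_def)
  have partial_inner: "partial j (\<lambda>p. a \<bullet> x (\<phi> p)) p = a \<bullet> d j p" if "p \<in> Q" for a j p
    using frechet_derivative_at[OF has_derivative_inner_right[OF has_derivative_compose[OF
      smooth_on_has_derivative[OF Q(2) that] smooth_on_has_derivative[OF smooth_x Q(3)[OF that]]]]]
    unfolding partial_def d_def by metis
  have t_d: "t \<bullet> d j p = axis j 1 $ 1" if "p \<in> Q" for j p
  proof -
    have "((\<lambda>p. t \<bullet> x (\<phi> p)) has_derivative (\<lambda>v. v $ 1)) (at p)"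
      by (rule has_derivative_transform_within_open[OF
            bounded_linear_imp_has_derivative[OF bounded_linear_vec_nth] Q(1) that])
        (use f\<phi> in \<open>simp add: Q_def f_def\<close>)
    from frechet_derivative_at[OF this] show ?thesis
      unfolding partial_inner[OF that, symmetric] partial_def by metis
  qed
  have n_d: "n \<bullet> d j p = slope1 (\<phi> p) * axis j 1 $ 1 + slope2 (\<phi> p) * (s \<bullet> d j p)" if "p \<in> Q" for j p
    using derivative_in_frame[OF Q(3)[OF that]] t_d[OF that] by (simp add: d_def)
  \<comment> \<open>In the chart, the second partial derivative of \<open>x\<close> is \<open>b\<^sub>v\<close> times \<open>tangent2\<close>. At a regular point
    \<open>D x\<close> is injective, hence \<open>\<phi>\<^sub>v = b\<^sub>v \<zeta>\<close> and the factor \<open>b\<^sub>v\<close> comes out of the derivative of the slope.\<close>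
  have slope_eq: "partial 2 (\<lambda>p. slope2 (\<phi> p)) p = H (\<phi> p) * partial 2 b p" if "p \<in> Q" for p
  proof (rule eq_off_singular_set_imp_eq[OF diffeoQ no_interior _ _ _ that])
    show "continuous_on Q (partial 2 (\<lambda>p. slope2 (\<phi> p)))"
      by (intro smooth_on_continuous_on smooth_on_partial comp smooth_slope2)
    show "continuous_on Q (\<lambda>p. H (\<phi> p) * partial 2 b p)"
      by (intro smooth_on_continuous_on smooth_on_mult smooth_on_partial comp smooth_H smooth_b Q(1))
    fix p assume p: "p \<in> Q" and "\<phi> p \<notin> singular_set U x"
    then have regular: "\<phi> p \<in> U1 - singular_set U1 x" "\<phi> p \<in> U - singular_set U x"
      using singular Q(3) \<open>U1 \<subseteq> U\<close> by auto
    have inj: "inj (frechet_derivative x (at (\<phi> p)))"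
      using regular(1) by (simp add: singular_set_def)
    have lin: "linear (frechet_derivative x (at (\<phi> p)))" "linear (frechet_derivative slope2 (at (\<phi> p)))"
      using smooth_on_has_derivative[OF _ Q(3)[OF p]] smooth_x smooth_slope2 has_derivative_linear by blast+
    obtain \<zeta> where \<zeta>: "frechet_derivative x (at (\<phi> p)) \<zeta> = tangent2 (\<phi> p)"
      "frechet_derivative slope2 (at (\<phi> p)) \<zeta> = H (\<phi> p)"
      using slope2_derivative_regular[OF regular(1)] K[OF regular(2) coords2_neq_0[OF Q(3)[OF p]]]
      unfolding H_def by metis
    have "d 2 p = partial 2 b p *\<^sub>R tangent2 (\<phi> p)"
      using t_d[OF p, of 2] n_d[OF p, of 2] partial_inner[OF p, of 2 s]
      by (intro eq_in_frame) (simp_all add: tangent2_in_frame axis_def b_def[abs_def])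
    then have "frechet_derivative x (at (\<phi> p)) (partial 2 \<phi> p) =
        frechet_derivative x (at (\<phi> p)) (partial 2 b p *\<^sub>R \<zeta>)"
      by (simp add: d_def \<zeta>(1) linear_cmul[OF lin(1)])
    then have "partial 2 \<phi> p = partial 2 b p *\<^sub>R \<zeta>"
      using inj by (simp add: inj_eq)
    then show "partial 2 (\<lambda>p. slope2 (\<phi> p)) p = H (\<phi> p) * partial 2 b p"
      by (simp add: partial_comp[OF smooth_slope2 p] linear_cmul[OF lin(2)] \<zeta>(2))
  qed
  have axis_smooth: "smooth_on {-\<epsilon><..<\<epsilon>} (\<lambda>u. F (vector [u, 0]))" if "smooth_on Q F" for F :: "real^2 \<Rightarrow> real"
  proof (rule smooth_on_compose[OF _ Q(1) that])
    show "smooth_on {-\<epsilon><..<\<epsilon>} (\<lambda>u. vector [u, 0] :: real^2)"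
      by (intro smooth_on_vector_2 smooth_on_const smooth_on_bounded_linear bounded_linear_ident) simp_all
    show "(\<lambda>u. vector [u, 0] :: real^2) ` {-\<epsilon><..<\<epsilon>} \<subseteq> Q"
      using \<epsilon> by (auto simp: Q_def)
  qed simp
  have smooth_l: "smooth_on {-\<epsilon><..<\<epsilon>} l" and smooth_r: "smooth_on {-\<epsilon><..<\<epsilon>} r"
    unfolding l_def r_def by (intro axis_smooth smooth_on_partial comp smooth_slope1 smooth_slope2)+
  have "w 0 = norm w0 *\<^sub>R n"
    using w0 by (simp add: w_def n_def flip: w0_def)
  then have "slope1 0 = 0" "slope2 0 = 0"
    using orthogonal_tn orthonormal_s by (simp_all add: slope1_def slope2_def inner_commute)
  then have init: "c 0 = 0" "slope1 (\<phi> 0) = 0" "slope2 (\<phi> 0) = 0"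
    using \<phi>0 assms(3) by (simp_all add: c_def)
  have form: "frame *v x (\<phi> (vector [u, v])) = normal_form b (\<lambda>p. H (\<phi> p)) l r u v"
    if "\<bar>u\<bar> < \<epsilon>" "\<bar>v\<bar> < \<epsilon>" for u v
  proof -
    have "normal_form b (\<lambda>p. H (\<phi> p)) l r u v = vector [u, b (vector [u, v]), c (vector [u, v])]"
      unfolding l_def r_def
    proof (rule normal_form_eq_graph[OF Q_def smooth_b smooth_c comp[OF smooth_slope1] comp[OF smooth_slope2]
          comp[OF smooth_H] init _ _ slope_eq that])
      show "partial 1 c p = slope1 (\<phi> p) + slope2 (\<phi> p) * partial 1 b p" if "p \<in> Q" for p
        using n_d[OF that, of 1] by (simp add: b_def[abs_def] c_def[abs_def] partial_inner[OF that])
      show "partial 2 c p = slope2 (\<phi> p) * partial 2 b p" if "p \<in> Q" for p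
        using n_d[OF that, of 2] by (simp add: b_def[abs_def] c_def[abs_def] partial_inner[OF that] axis_def)
    qed
    moreover have "t \<bullet> x (\<phi> (vector [u, v])) = u"
      using f\<phi>[of "vector [u, v]"] that by (simp add: f_def)
    ultimately show ?thesis
      by (simp add: frame_mult b_def c_def)
  qed
  have "rigid_motion ((*v) frame)"
    unfolding rigid_motion_def using rotation_frame by (intro exI[of _ frame] exI[of _ 0]) simp
  then show ?thesis
    using \<epsilon> W \<open>U1 \<subseteq> U\<close> diffeo \<phi>0 smooth_b[unfolded Q_def] comp[OF smooth_H, unfolded Q_def] smooth_l smooth_r form
    by (intro exI[of _ "(*v) frame"] exI[of _ \<phi>] exI[of _ W] exI[of _ \<epsilon>] exI[of _ b]
        exI[of _ "\<lambda>p. H (\<phi> p)"] exI[of _ l] exI[of _ r]) auto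
qed

end
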